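(* Let $\mathcal{E}$ be a category with finite limits. Then $\mathcal{E}$ has a natural numbers object if and only if the $2$-category $\mathbf{Cat}(\mathcal{E})$ has a natural numbers object. In this case, the functors $\mathbf{disc}:\mathcal{E}\to\mathbf{Cat}(\mathcal{E})_1$, $(-)_0:\mathbf{Cat}(\mathcal{E})_1\to\mathcal{E}$ and (when $\mathcal{E}$ has coequalisers of reflexive pairs, so that it is defined) $\Pi_0:\mathbf{Cat}(\mathcal{E})_1\to\mathcal{E}$ all preserve the natural numbers object.
   Context: $\mathbf{Cat}(\mathcal{E})$ is the $2$-category of categories, functors and natural transformations internal to $\mathcal{E}$, and $\mathbf{Cat}(\mathcal{E})_1$ is its underlying category. $(-)_0$ sends an internal category to its object of objects; $\mathbf{disc}$ sends $X$ to the discrete internal category on $X$; $\Pi_0$ (the left adjoint of $\mathbf{disc}$) sends an internal category $\mathbb{A}$ to the coequaliser of its source and target maps $A_1\rightrightarrows A_0$. A natural numbers object in a category with terminal object $\mathbf 1$ is $\mathbf{1}\xrightarrow{z}N\xrightarrow{s}N$ such that for any $\mathbf{1}\xrightarrow{f}X\xrightarrow{g}X$ there is a unique $u:N\to X$ with $uz=f$ and $us=gu$. A natural numbers object in a $2$-category $\mathcal{K}$ with terminal object $\underline{\mathbf 1}$ is $\underline{\mathbf 1}\xrightarrow{z}\underline N\xrightarrow{s}\underline N$ which is a natural numbers object in the underlying category and such that, for all $f,f':\underline{\mathbf 1}\to X$ and $g:X\to X$ with corresponding $u,u':\underline N\to X$ (for $(f,g)$ and $(f',g)$ respectively), and every $2$-cell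 $\alpha:f\Rightarrow f'$, there is a unique $2$-cell $\phi:u\Rightarrow u'$ with $\phi z=\alpha$ and $\phi s=g\phi$. "Preserve" means up to isomorphism. *)

theory Defs
  imports Main
begin

section \<open>Categories and functors\<close>

record ('o, 'a) cat =
  Ob :: "'o set"
  Ar :: "'a set"
  Dom :: "'a \<Rightarrow> 'o"
  Cod :: "'a \<Rightarrow> 'o"
  Ident :: "'o \<Rightarrow> 'a"
  Comp :: "'a \<Rightarrow> 'a \<Rightarrow> 'a"  (infixr "\<cdot>\<index>" 70)

definition hom :: "('o, 'a, 'm) cat_scheme \<Rightarrow> 'o \<Rightarrow> 'o \<Rightarrow> 'a set" where
  "hom C X Y = {f \<in> Ar C. Dom C f = X \<and> Cod C f = Y}"

locale category =
  fixes C :: "('o, 'a, 'm) cat_scheme" (structure)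
  assumes Dom_Ob: "f \<in> Ar C \<Longrightarrow> Dom C f \<in> Ob C"
    and Cod_Ob: "f \<in> Ar C \<Longrightarrow> Cod C f \<in> Ob C"
    and Ident_hom: "X \<in> Ob C \<Longrightarrow> Ident C X \<in> hom C X X"
    and Comp_hom: "g \<in> hom C Y Z \<Longrightarrow> f \<in> hom C X Y \<Longrightarrow> g \<cdot> f \<in> hom C X Z"
    and Comp_Ident: "f \<in> hom C X Y \<Longrightarrow> f \<cdot> Ident C X = f"
    and Ident_Comp: "f \<in> hom C X Y \<Longrightarrow> Ident C Y \<cdot> f = f"
    and Comp_assoc:
      "h \<in> hom C Y Z \<Longrightarrow> g \<in> hom C X Y \<Longrightarrow> f \<in> hom C W X \<Longrightarrow> (h \<cdot> g) \<cdot> f = h \<cdot> (g \<cdot> f)"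

record ('o, 'a, 'p, 'b) fctr =
  Fob :: "'o \<Rightarrow> 'p"
  Far :: "'a \<Rightarrow> 'b"

definition is_functor ::
  "('o, 'a, 'm) cat_scheme \<Rightarrow> ('p, 'b, 'n) cat_scheme \<Rightarrow> ('o, 'a, 'p, 'b) fctr \<Rightarrow> bool" where
  "is_functor C D F \<longleftrightarrow>
     (\<forall>X\<in>Ob C. Fob F X \<in> Ob D) \<and>
     (\<forall>f\<in>Ar C. Far F f \<in> hom D (Fob F (Dom C f)) (Fob F (Cod C f))) \<and>
     (\<forall>X\<in>Ob C. Far F (Ident C X) = Ident D (Fob F X)) \<and>
     (\<forall>f\<in>Ar C. \<forall>g\<in>Ar C. Dom C g = Cod C f \<longrightarrow>
        Far F (g \<cdot>\<^bsub>C\<^esub> f) = Far F g \<cdot>\<^bsub>D\<^esub> Far F f)"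

section \<open>Limits and colimits\<close>

definition is_cone ::
  "('j, 'k, 'm) cat_scheme \<Rightarrow> ('o, 'a, 'n) cat_scheme \<Rightarrow> ('j, 'k, 'o, 'a) fctr \<Rightarrow> 'o \<Rightarrow> ('j \<Rightarrow> 'a) \<Rightarrow> bool" where
  "is_cone J C D L c \<longleftrightarrow>
     L \<in> Ob C \<and> (\<forall>j\<in>Ob J. c j \<in> hom C L (Fob D j)) \<and>
     (\<forall>k\<in>Ar J. Far D k \<cdot>\<^bsub>C\<^esub> c (Dom J k) = c (Cod J k))"

definition is_limit ::
  "('j, 'k, 'm) cat_scheme \<Rightarrow> ('o, 'a, 'n) cat_scheme \<Rightarrow> ('j, 'k, 'o, 'a) fctr \<Rightarrow> 'o \<Rightarrow> ('j \<Rightarrow> 'a) \<Rightarrow> bool" where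
  "is_limit J C D L c \<longleftrightarrow>
     is_cone J C D L c \<and>
     (\<forall>M d. is_cone J C D M d \<longrightarrow>
        (\<exists>!h. h \<in> hom C M L \<and> (\<forall>j\<in>Ob J. c j \<cdot>\<^bsub>C\<^esub> h = d j)))"

text \<open>Every finite category is isomorphic to one whose objects and arrows are natural numbers,
  so it suffices to range over diagram shapes of the latter kind.\<close>

definition has_finite_limits :: "('o, 'a, 'm) cat_scheme \<Rightarrow> bool" where
  "has_finite_limits C \<longleftrightarrow>
     (\<forall>(J :: (nat, nat) cat) D.
        category J \<and> finite (Ob J) \<and> finite (Ar J) \<and> is_functor J C D \<longrightarrow>
        (\<exists>L c. is_limit J C D L c))"

definition terminal :: "('o, 'a, 'm) cat_scheme \<Rightarrow> 'o \<Rightarrow> bool" where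
  "terminal C T \<longleftrightarrow> T \<in> Ob C \<and> (\<forall>X\<in>Ob C. \<exists>!f. f \<in> hom C X T)"

definition is_pullback :: "('o, 'a, 'm) cat_scheme \<Rightarrow> 'a \<Rightarrow> 'a \<Rightarrow> 'a \<Rightarrow> 'a \<Rightarrow> bool" where
  "is_pullback C f g p q \<longleftrightarrow>
     f \<in> Ar C \<and> g \<in> Ar C \<and> Cod C f = Cod C g \<and>
     p \<in> hom C (Dom C p) (Dom C f) \<and> q \<in> hom C (Dom C p) (Dom C g) \<and>
     f \<cdot>\<^bsub>C\<^esub> p = g \<cdot>\<^bsub>C\<^esub> q \<and>
     (\<forall>X x y. x \<in> hom C X (Dom C f) \<and> y \<in> hom C X (Dom C g) \<and> f \<cdot>\<^bsub>C\<^esub> x = g \<cdot>\<^bsub>C\<^esub> y \<longrightarrow>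
        (\<exists>!u. u \<in> hom C X (Dom C p) \<and> p \<cdot>\<^bsub>C\<^esub> u = x \<and> q \<cdot>\<^bsub>C\<^esub> u = y))"

text \<open>Chosen pullbacks: \<open>pb1\<close> and \<open>pb2\<close> are the projections from \<open>pb\<close>, and \<open>pb_pair C f g x y\<close>
  is the arrow into \<open>pb C f g\<close> induced by \<open>x\<close> and \<open>y\<close>.\<close>

definition pb_proj :: "('o, 'a, 'm) cat_scheme \<Rightarrow> 'a \<Rightarrow> 'a \<Rightarrow> 'a \<times> 'a" where
  "pb_proj C f g = (SOME pq. is_pullback C f g (fst pq) (snd pq))"

definition pb1 :: "('o, 'a, 'm) cat_scheme \<Rightarrow> 'a \<Rightarrow> 'a \<Rightarrow> 'a" where
  "pb1 C f g = fst (pb_proj C f g)"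

definition pb2 :: "('o, 'a, 'm) cat_scheme \<Rightarrow> 'a \<Rightarrow> 'a \<Rightarrow> 'a" where
  "pb2 C f g = snd (pb_proj C f g)"

definition pb :: "('o, 'a, 'm) cat_scheme \<Rightarrow> 'a \<Rightarrow> 'a \<Rightarrow> 'o" where
  "pb C f g = Dom C (pb1 C f g)"

definition pb_pair :: "('o, 'a, 'm) cat_scheme \<Rightarrow> 'a \<Rightarrow> 'a \<Rightarrow> 'a \<Rightarrow> 'a \<Rightarrow> 'a" where
  "pb_pair C f g x y =
     (THE u. u \<in> hom C (Dom C x) (pb C f g) \<and>
             pb1 C f g \<cdot>\<^bsub>C\<^esub> u = x \<and> pb2 C f g \<cdot>\<^bsub>C\<^esub> u = y)"

definition is_coequaliser :: "('o, 'a, 'm) cat_scheme \<Rightarrow> 'a \<Rightarrow> 'a \<Rightarrow> 'a \<Rightarrow> bool" where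
  "is_coequaliser C f g q \<longleftrightarrow>
     f \<in> Ar C \<and> g \<in> hom C (Dom C f) (Cod C f) \<and>
     q \<in> hom C (Cod C f) (Cod C q) \<and> q \<cdot>\<^bsub>C\<^esub> f = q \<cdot>\<^bsub>C\<^esub> g \<and>
     (\<forall>X x. x \<in> hom C (Cod C f) X \<and> x \<cdot>\<^bsub>C\<^esub> f = x \<cdot>\<^bsub>C\<^esub> g \<longrightarrow>
        (\<exists>!u. u \<in> hom C (Cod C q) X \<and> u \<cdot>\<^bsub>C\<^esub> q = x))"

definition coeq :: "('o, 'a, 'm) cat_scheme \<Rightarrow> 'a \<Rightarrow> 'a \<Rightarrow> 'a" where
  "coeq C f g = (SOME q. is_coequaliser C f g q)"

definition reflexive_pair :: "('o, 'a, 'm) cat_scheme \<Rightarrow> 'a \<Rightarrow> 'a \<Rightarrow> bool" where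
  "reflexive_pair C f g \<longleftrightarrow>
     f \<in> Ar C \<and> g \<in> hom C (Dom C f) (Cod C f) \<and>
     (\<exists>r \<in> hom C (Cod C f) (Dom C f).
        f \<cdot>\<^bsub>C\<^esub> r = Ident C (Cod C f) \<and> g \<cdot>\<^bsub>C\<^esub> r = Ident C (Cod C f))"

definition has_reflexive_coequalisers :: "('o, 'a, 'm) cat_scheme \<Rightarrow> bool" where
  "has_reflexive_coequalisers C \<longleftrightarrow>
     (\<forall>f g. reflexive_pair C f g \<longrightarrow> (\<exists>q. is_coequaliser C f g q))"

section \<open>2-categories\<close>

text \<open>\<open>Src\<close> and \<open>Tgt\<close> give the 1-cells between which a 2-cell runs. All composites, vertical and
  horizontal ones included, are written in applicative order.\<close>

record ('o, 'a, 'c) cat2 = "('o, 'a) cat" +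
  Cell :: "'c set"
  Src :: "'c \<Rightarrow> 'a"
  Tgt :: "'c \<Rightarrow> 'a"
  VIdent :: "'a \<Rightarrow> 'c"
  VComp :: "'c \<Rightarrow> 'c \<Rightarrow> 'c"
  HComp :: "'c \<Rightarrow> 'c \<Rightarrow> 'c"

definition underlying :: "('o, 'a, 'c, 'm) cat2_scheme \<Rightarrow> ('o, 'a) cat" where
  "underlying K = cat.truncate K"

definition cells :: "('o, 'a, 'c, 'm) cat2_scheme \<Rightarrow> 'a \<Rightarrow> 'a \<Rightarrow> 'c set" where
  "cells K f g = {\<alpha> \<in> Cell K. Src K \<alpha> = f \<and> Tgt K \<alpha> = g}"

locale two_category =
  fixes K :: "('o, 'a, 'c, 'm) cat2_scheme"
  assumes underlying_category: "category (underlying K)"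
    and Cell_parallel:
      "\<alpha> \<in> Cell K \<Longrightarrow> Src K \<alpha> \<in> Ar K \<and> Tgt K \<alpha> \<in> hom K (Dom K (Src K \<alpha>)) (Cod K (Src K \<alpha>))"
    and VIdent_cells: "f \<in> Ar K \<Longrightarrow> VIdent K f \<in> cells K f f"
    and VComp_cells: "\<beta> \<in> cells K g h \<Longrightarrow> \<alpha> \<in> cells K f g \<Longrightarrow> VComp K \<beta> \<alpha> \<in> cells K f h"
    and VComp_VIdent: "\<alpha> \<in> cells K f g \<Longrightarrow> VComp K \<alpha> (VIdent K f) = \<alpha>"
    and VIdent_VComp: "\<alpha> \<in> cells K f g \<Longrightarrow> VComp K (VIdent K g) \<alpha> = \<alpha>"
    and VComp_assoc:
      "\<gamma> \<in> cells K h k \<Longrightarrow> \<beta> \<in> cells K g h \<Longrightarrow> \<alpha> \<in> cells K f g \<Longrightarrow>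
       VComp K (VComp K \<gamma> \<beta>) \<alpha> = VComp K \<gamma> (VComp K \<beta> \<alpha>)"
    and HComp_cells:
      "\<beta> \<in> cells K g g' \<Longrightarrow> \<alpha> \<in> cells K f f' \<Longrightarrow> Dom K g = Cod K f \<Longrightarrow>
       HComp K \<beta> \<alpha> \<in> cells K (g \<cdot>\<^bsub>K\<^esub> f) (g' \<cdot>\<^bsub>K\<^esub> f')"
    and HComp_VIdent_Ident:
      "\<alpha> \<in> cells K f g \<Longrightarrow> HComp K \<alpha> (VIdent K (Ident K (Dom K f))) = \<alpha>"
    and VIdent_Ident_HComp:
      "\<alpha> \<in> cells K f g \<Longrightarrow> HComp K (VIdent K (Ident K (Cod K f))) \<alpha> = \<alpha>"
    and HComp_assoc:
      "\<gamma> \<in> cells K h h' \<Longrightarrow> \<beta> \<in> cells K g g' \<Longrightarrow> \<alpha> \<in> cells K f f' \<Longrightarrow>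
       Dom K h = Cod K g \<Longrightarrow> Dom K g = Cod K f \<Longrightarrow>
       HComp K (HComp K \<gamma> \<beta>) \<alpha> = HComp K \<gamma> (HComp K \<beta> \<alpha>)"
    and HComp_VIdent:
      "g \<in> Ar K \<Longrightarrow> f \<in> Ar K \<Longrightarrow> Dom K g = Cod K f \<Longrightarrow>
       HComp K (VIdent K g) (VIdent K f) = VIdent K (g \<cdot>\<^bsub>K\<^esub> f)"
    and interchange:
      "\<beta> \<in> cells K g g' \<Longrightarrow> \<beta>' \<in> cells K g' g'' \<Longrightarrow> \<alpha> \<in> cells K f f' \<Longrightarrow> \<alpha>' \<in> cells K f' f'' \<Longrightarrow>
       Dom K g = Cod K f \<Longrightarrow>
       HComp K (VComp K \<beta>' \<beta>) (VComp K \<alpha>' \<alpha>) = VComp K (HComp K \<beta>' \<alpha>') (HComp K \<beta> \<alpha>)"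

definition whisker_right :: "('o, 'a, 'c, 'm) cat2_scheme \<Rightarrow> 'c \<Rightarrow> 'a \<Rightarrow> 'c" where
  "whisker_right K \<phi> f = HComp K \<phi> (VIdent K f)"

definition whisker_left :: "('o, 'a, 'c, 'm) cat2_scheme \<Rightarrow> 'a \<Rightarrow> 'c \<Rightarrow> 'c" where
  "whisker_left K g \<phi> = HComp K (VIdent K g) \<phi>"

definition terminal2 :: "('o, 'a, 'c, 'm) cat2_scheme \<Rightarrow> 'o \<Rightarrow> bool" where
  "terminal2 K T \<longleftrightarrow>
     terminal (underlying K) T \<and>
     (\<forall>X\<in>Ob K. \<forall>f\<in>hom K X T. \<forall>g\<in>hom K X T. \<exists>!\<alpha>. \<alpha> \<in> cells K f g)"

section \<open>Natural numbers objects\<close>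

definition nno :: "('o, 'a, 'm) cat_scheme \<Rightarrow> 'o \<Rightarrow> 'o \<Rightarrow> 'a \<Rightarrow> 'a \<Rightarrow> bool" where
  "nno C T N z s \<longleftrightarrow>
     terminal C T \<and> N \<in> Ob C \<and> z \<in> hom C T N \<and> s \<in> hom C N N \<and>
     (\<forall>X\<in>Ob C. \<forall>f\<in>hom C T X. \<forall>g\<in>hom C X X.
        \<exists>!u. u \<in> hom C N X \<and> u \<cdot>\<^bsub>C\<^esub> z = f \<and> u \<cdot>\<^bsub>C\<^esub> s = g \<cdot>\<^bsub>C\<^esub> u)"

definition has_nno :: "('o, 'a, 'm) cat_scheme \<Rightarrow> bool" where
  "has_nno C \<longleftrightarrow> (\<exists>T N z s. nno C T N z s)"

definition nno2 :: "('o, 'a, 'c, 'm) cat2_scheme \<Rightarrow> 'o \<Rightarrow> 'o \<Rightarrow> 'a \<Rightarrow> 'a \<Rightarrow> bool" where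
  "nno2 K T N z s \<longleftrightarrow>
     terminal2 K T \<and> nno (underlying K) T N z s \<and>
     (\<forall>X\<in>Ob K. \<forall>f\<in>hom K T X. \<forall>f'\<in>hom K T X. \<forall>g\<in>hom K X X.
        \<forall>u\<in>hom K N X. \<forall>u'\<in>hom K N X.
        u \<cdot>\<^bsub>K\<^esub> z = f \<and> u \<cdot>\<^bsub>K\<^esub> s = g \<cdot>\<^bsub>K\<^esub> u \<and>
        u' \<cdot>\<^bsub>K\<^esub> z = f' \<and> u' \<cdot>\<^bsub>K\<^esub> s = g \<cdot>\<^bsub>K\<^esub> u' \<longrightarrow>
        (\<forall>\<alpha>\<in>cells K f f'. \<exists>!\<phi>. \<phi> \<in> cells K u u' \<and>
           whisker_right K \<phi> z = \<alpha> \<and> whisker_right K \<phi> s = whisker_left K g \<phi>))"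

definition has_nno2 :: "('o, 'a, 'c, 'm) cat2_scheme \<Rightarrow> bool" where
  "has_nno2 K \<longleftrightarrow> (\<exists>T N z s. nno2 K T N z s)"

text \<open>Since \<open>nno\<close> does not refer to a chosen terminal object or a chosen natural numbers object,
  the following is preservation up to isomorphism.\<close>

definition preserves_nno ::
  "('o, 'a, 'm) cat_scheme \<Rightarrow> ('p, 'b, 'n) cat_scheme \<Rightarrow> ('o, 'a, 'p, 'b) fctr \<Rightarrow> bool" where
  "preserves_nno C D F \<longleftrightarrow>
     (\<forall>T N z s. nno C T N z s \<longrightarrow> nno D (Fob F T) (Fob F N) (Far F z) (Far F s))"

section \<open>Internal categories\<close>

record ('o, 'a) icat =
  ob0 :: 'o
  ob1 :: 'o
  isrc :: 'a
  itgt :: 'a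
  iid :: 'a
  icmp :: 'a

text \<open>The object of composable pairs of \<open>A\<close> is the chosen pullback of \<open>itgt A\<close> along \<open>isrc A\<close>: its
  first component is the arrow to be applied first. For generalised arrows \<open>x\<close> and \<open>y\<close> of \<open>A\<close>,
  \<open>icomp E A x y\<close> is the composite ``first \<open>x\<close>, then \<open>y\<close>''.\<close>

abbreviation ipairs :: "('o, 'a, 'm) cat_scheme \<Rightarrow> ('o, 'a) icat \<Rightarrow> 'o" where
  "ipairs E A \<equiv> pb E (itgt A) (isrc A)"

abbreviation ipair1 :: "('o, 'a, 'm) cat_scheme \<Rightarrow> ('o, 'a) icat \<Rightarrow> 'a" where
  "ipair1 E A \<equiv> pb1 E (itgt A) (isrc A)"

abbreviation ipair2 :: "('o, 'a, 'm) cat_scheme \<Rightarrow> ('o, 'a) icat \<Rightarrow> 'a" where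
  "ipair2 E A \<equiv> pb2 E (itgt A) (isrc A)"

definition icomp :: "('o, 'a, 'm) cat_scheme \<Rightarrow> ('o, 'a) icat \<Rightarrow> 'a \<Rightarrow> 'a \<Rightarrow> 'a" where
  "icomp E A x y = icmp A \<cdot>\<^bsub>E\<^esub> pb_pair E (itgt A) (isrc A) x y"

text \<open>In the associativity law, the object of composable triples is the pullback of the second
  along the first projection of the object of composable pairs.\<close>

definition is_icat :: "('o, 'a, 'm) cat_scheme \<Rightarrow> ('o, 'a) icat \<Rightarrow> bool" where
  "is_icat E A \<longleftrightarrow>
     ob0 A \<in> Ob E \<and> ob1 A \<in> Ob E \<and>
     isrc A \<in> hom E (ob1 A) (ob0 A) \<and> itgt A \<in> hom E (ob1 A) (ob0 A) \<and>
     iid A \<in> hom E (ob0 A) (ob1 A) \<and> icmp A \<in> hom E (ipairs E A) (ob1 A) \<and>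
     isrc A \<cdot>\<^bsub>E\<^esub> iid A = Ident E (ob0 A) \<and> itgt A \<cdot>\<^bsub>E\<^esub> iid A = Ident E (ob0 A) \<and>
     isrc A \<cdot>\<^bsub>E\<^esub> icmp A = isrc A \<cdot>\<^bsub>E\<^esub> ipair1 E A \<and>
     itgt A \<cdot>\<^bsub>E\<^esub> icmp A = itgt A \<cdot>\<^bsub>E\<^esub> ipair2 E A \<and>
     icomp E A (iid A \<cdot>\<^bsub>E\<^esub> isrc A) (Ident E (ob1 A)) = Ident E (ob1 A) \<and>
     icomp E A (Ident E (ob1 A)) (iid A \<cdot>\<^bsub>E\<^esub> itgt A) = Ident E (ob1 A) \<and>
     (let r1 = pb1 E (ipair2 E A) (ipair1 E A); r2 = pb2 E (ipair2 E A) (ipair1 E A)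
      in icomp E A (icmp A \<cdot>\<^bsub>E\<^esub> r1) (ipair2 E A \<cdot>\<^bsub>E\<^esub> r2) =
         icomp E A (ipair1 E A \<cdot>\<^bsub>E\<^esub> r1) (icmp A \<cdot>\<^bsub>E\<^esub> r2))"

record ('o, 'a) ifun =
  fdom :: "('o, 'a) icat"
  fcod :: "('o, 'a) icat"
  fob :: 'a
  far :: 'a

definition is_ifun :: "('o, 'a, 'm) cat_scheme \<Rightarrow> ('o, 'a) ifun \<Rightarrow> bool" where
  "is_ifun E F \<longleftrightarrow>
     (let A = fdom F; B = fcod F in
      is_icat E A \<and> is_icat E B \<and>
      fob F \<in> hom E (ob0 A) (ob0 B) \<and> far F \<in> hom E (ob1 A) (ob1 B) \<and>
      isrc B \<cdot>\<^bsub>E\<^esub> far F = fob F \<cdot>\<^bsub>E\<^esub> isrc A \<and>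
      itgt B \<cdot>\<^bsub>E\<^esub> far F = fob F \<cdot>\<^bsub>E\<^esub> itgt A \<and>
      far F \<cdot>\<^bsub>E\<^esub> iid A = iid B \<cdot>\<^bsub>E\<^esub> fob F \<and>
      far F \<cdot>\<^bsub>E\<^esub> icmp A =
        icomp E B (far F \<cdot>\<^bsub>E\<^esub> ipair1 E A) (far F \<cdot>\<^bsub>E\<^esub> ipair2 E A))"

record ('o, 'a) inat =
  nsrc :: "('o, 'a) ifun"
  ntgt :: "('o, 'a) ifun"
  ncomp :: 'a

definition is_inat :: "('o, 'a, 'm) cat_scheme \<Rightarrow> ('o, 'a) inat \<Rightarrow> bool" where
  "is_inat E \<alpha> \<longleftrightarrow>
     (let F = nsrc \<alpha>; G = ntgt \<alpha>; A = fdom F; B = fcod F in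
      is_ifun E F \<and> is_ifun E G \<and> fdom G = A \<and> fcod G = B \<and>
      ncomp \<alpha> \<in> hom E (ob0 A) (ob1 B) \<and>
      isrc B \<cdot>\<^bsub>E\<^esub> ncomp \<alpha> = fob F \<and> itgt B \<cdot>\<^bsub>E\<^esub> ncomp \<alpha> = fob G \<and>
      icomp E B (far F) (ncomp \<alpha> \<cdot>\<^bsub>E\<^esub> itgt A) =
      icomp E B (ncomp \<alpha> \<cdot>\<^bsub>E\<^esub> isrc A) (far G))"

definition ifun_comp ::
  "('o, 'a, 'm) cat_scheme \<Rightarrow> ('o, 'a) ifun \<Rightarrow> ('o, 'a) ifun \<Rightarrow> ('o, 'a) ifun" where
  "ifun_comp E G F =
     \<lparr>fdom = fdom F, fcod = fcod G, fob = fob G \<cdot>\<^bsub>E\<^esub> fob F, far = far G \<cdot>\<^bsub>E\<^esub> far F\<rparr>"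

text \<open>In the horizontal composite of \<open>\<beta> : G \<Rightarrow> G'\<close> and \<open>\<alpha> : F \<Rightarrow> F'\<close>, the component at \<open>a\<close> is
  \<open>G(\<alpha>_a)\<close> followed by \<open>\<beta>_(F' a)\<close>.\<close>

definition Cat ::
  "('o, 'a, 'm) cat_scheme \<Rightarrow> (('o, 'a) icat, ('o, 'a) ifun, ('o, 'a) inat) cat2" where
  "Cat E =
     \<lparr>Ob = {A. is_icat E A},
      Ar = {F. is_ifun E F},
      Dom = fdom,
      Cod = fcod,
      Ident = (\<lambda>A. \<lparr>fdom = A, fcod = A, fob = Ident E (ob0 A), far = Ident E (ob1 A)\<rparr>),
      Comp = ifun_comp E,
      Cell = {\<alpha>. is_inat E \<alpha>},
      Src = nsrc,
      Tgt = ntgt,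
      VIdent = (\<lambda>F. \<lparr>nsrc = F, ntgt = F, ncomp = iid (fcod F) \<cdot>\<^bsub>E\<^esub> fob F\<rparr>),
      VComp = (\<lambda>\<beta> \<alpha>. \<lparr>nsrc = nsrc \<alpha>, ntgt = ntgt \<beta>,
         ncomp = icomp E (fcod (nsrc \<alpha>)) (ncomp \<alpha>) (ncomp \<beta>)\<rparr>),
      HComp = (\<lambda>\<beta> \<alpha>. \<lparr>nsrc = ifun_comp E (nsrc \<beta>) (nsrc \<alpha>), ntgt = ifun_comp E (ntgt \<beta>) (ntgt \<alpha>),
         ncomp = icomp E (fcod (nsrc \<beta>))
           (far (nsrc \<beta>) \<cdot>\<^bsub>E\<^esub> ncomp \<alpha>) (ncomp \<beta> \<cdot>\<^bsub>E\<^esub> fob (ntgt \<alpha>))\<rparr>)\<rparr>"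

section \<open>The functors between a category and its category of internal categories\<close>

text \<open>All structure maps of a discrete internal category are identities, except that its
  composition is the (invertible) projection from the chosen pullback of two identities.\<close>

definition disc_icat :: "('o, 'a, 'm) cat_scheme \<Rightarrow> 'o \<Rightarrow> ('o, 'a) icat" where
  "disc_icat E X =
     \<lparr>ob0 = X, ob1 = X, isrc = Ident E X, itgt = Ident E X, iid = Ident E X,
      icmp = pb1 E (Ident E X) (Ident E X)\<rparr>"

definition disc ::
  "('o, 'a, 'm) cat_scheme \<Rightarrow> ('o, 'a, ('o, 'a) icat, ('o, 'a) ifun) fctr" where
  "disc E =
     \<lparr>Fob = disc_icat E,
      Far = (\<lambda>f. \<lparr>fdom = disc_icat E (Dom E f), fcod = disc_icat E (Cod E f), fob = f, far = f\<rparr>)\<rparr>"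

definition objs :: "(('o, 'a) icat, ('o, 'a) ifun, 'o, 'a) fctr" where
  "objs = \<lparr>Fob = ob0, Far = fob\<rparr>"

definition Pi0 ::
  "('o, 'a, 'm) cat_scheme \<Rightarrow> (('o, 'a) icat, ('o, 'a) ifun, 'o, 'a) fctr" where
  "Pi0 E =
     (let q = (\<lambda>A. coeq E (isrc A) (itgt A)) in
      \<lparr>Fob = (\<lambda>A. Cod E (q A)),
       Far = (\<lambda>F. THE u. u \<in> hom E (Cod E (q (fdom F))) (Cod E (q (fcod F))) \<and>
                         u \<cdot>\<^bsub>E\<^esub> q (fdom F) = q (fcod F) \<cdot>\<^bsub>E\<^esub> fob F)\<rparr>)"

section \<open>Well-definedness\<close>

text \<open>If \<open>E\<close> has finite limits then \<open>Cat E\<close> is a 2-category, and \<open>disc E\<close>, \<open>objs\<close> and \<open>Pi0 E\<close>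
  are functors.\<close>

locale finitely_complete_category = category E for E :: "('o, 'a, 'm) cat_scheme" (structure) +
  assumes finite_limits: "has_finite_limits E"
begin

lemma homD: "f \<in> hom E X Y \<Longrightarrow> f \<in> Ar E \<and> Dom E f = X \<and> Cod E f = Y \<and> X \<in> Ob E \<and> Y \<in> Ob E"
  by (auto simp: hom_def Dom_Ob Cod_Ob)

lemma homI: "f \<in> Ar E \<Longrightarrow> f \<in> hom E (Dom E f) (Cod E f)"
  by (auto simp: hom_def)

lemma square_comp:
  assumes "a \<cdot> b = c \<cdot> d" "a \<in> hom E Y Z" "b \<in> hom E X Y" "c \<in> hom E Y' Z'" "d \<in> hom E X Y'"
    "h \<in> hom E W X"
  shows "a \<cdot> (b \<cdot> h) = c \<cdot> (d \<cdot> h)"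
  using Comp_assoc[OF assms(2,3,6)] Comp_assoc[OF assms(4,5,6)] assms(1) by simp

lemma ident_comp:
  assumes "a \<cdot> b = Ident E X" "a \<in> hom E Y X" "b \<in> hom E X Y" "h \<in> hom E W X"
  shows "a \<cdot> (b \<cdot> h) = h"
  using Comp_assoc[OF assms(2-4)] Ident_Comp[OF assms(4)] assms(1) by simp

lemma pullback_exists:
  assumes f: "f \<in> hom E X Z" and g: "g \<in> hom E Y Z"
  shows "\<exists>p q. is_pullback E f g p q"
proof -
  note [simp] = homD[OF f] homD[OF g]
  define J :: "(nat, nat) cat" where
    "J = \<lparr>Ob = {0, 1, 2}, Ar = {0, 1, 2, 3, 4},
          Dom = (\<lambda>k. if k = 3 then 0 else if k = 4 then 1 else k),
          Cod = (\<lambda>k. if k = 3 \<or> k = 4 then 2 else k),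
          Ident = (\<lambda>j. j), Comp = (\<lambda>k l. if k = 3 \<or> k = 4 then k else l)\<rparr>"
  define D :: "(nat, nat, 'o, 'a) fctr" where
    "D = \<lparr>Fob = (\<lambda>j. if j = 0 then X else if j = 1 then Y else Z),
          Far = (\<lambda>k. if k = 0 then Ident E X else if k = 1 then Ident E Y
                 else if k = 2 then Ident E Z else if k = 3 then f else g)\<rparr>"
  have catJ: "category J"
    by (unfold_locales; auto simp: J_def hom_def split: if_splits)
  have XYZ: "X \<in> Ob E" "Y \<in> Ob E" "Z \<in> Ob E" by auto
  note idh = Ident_hom[OF XYZ(1)] Ident_hom[OF XYZ(2)] Ident_hom[OF XYZ(3)]
  have DJ: "is_functor J E D"
    using idh f g Ident_Comp[OF idh(1)] Ident_Comp[OF idh(2)] Ident_Comp[OF idh(3)]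
      Comp_Ident[OF f] Comp_Ident[OF g] Ident_Comp[OF f] Ident_Comp[OF g]
    unfolding is_functor_def by (auto simp: J_def D_def)
  have "finite (Ob J)" "finite (Ar J)" by (auto simp: J_def)
  with catJ DJ finite_limits obtain L c where L: "is_limit J E D L c"
    unfolding has_finite_limits_def by blast
  have cone: "is_cone J E D M d \<longleftrightarrow> d 0 \<in> hom E M X \<and> d 1 \<in> hom E M Y \<and> d 2 \<in> hom E M Z \<and>
       f \<cdot> d 0 = d 2 \<and> g \<cdot> d 1 = d 2" for M d
    unfolding is_cone_def by (auto simp: J_def D_def Ident_Comp dest: homD)
  have c: "c 0 \<in> hom E L X" "c 1 \<in> hom E L Y" "f \<cdot> c 0 = g \<cdot> c 1" "c 2 = f \<cdot> c 0"
    using L unfolding is_limit_def cone by auto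
  have "is_pullback E f g (c 0) (c 1)"
    unfolding is_pullback_def
  proof (intro conjI allI impI)
    fix W x y assume a: "x \<in> hom E W (Dom E f) \<and> y \<in> hom E W (Dom E g) \<and> f \<cdot> x = g \<cdot> y"
    define d where "d = (\<lambda>j::nat. if j = 0 then x else if j = 1 then y else f \<cdot> x)"
    have "is_cone J E D W d"
      unfolding cone using a Comp_hom[OF f, of x W] by (auto simp: d_def)
    then have ex: "\<exists>!h. h \<in> hom E W L \<and> (\<forall>j\<in>Ob J. c j \<cdot> h = d j)"
      using L unfolding is_limit_def by blast
    have "h \<in> hom E W L \<and> (\<forall>j\<in>Ob J. c j \<cdot> h = d j) \<longleftrightarrow> h \<in> hom E W L \<and> c 0 \<cdot> h = x \<and> c 1 \<cdot> h = y" for h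
      using Comp_assoc[OF f c(1), of h W] by (auto simp: J_def d_def c(4))
    with ex show "\<exists>!u. u \<in> hom E W (Dom E (c 0)) \<and> c 0 \<cdot> u = x \<and> c 1 \<cdot> u = y"
      using homD[OF c(1)] by simp
  qed (use c homD[OF c(1)] in auto)
  then show ?thesis by blast
qed

lemma pb_is_pullback:
  assumes "f \<in> hom E X Z" "g \<in> hom E Y Z"
  shows "is_pullback E f g (pb1 E f g) (pb2 E f g)"
proof -
  from pullback_exists[OF assms] have "\<exists>pq. is_pullback E f g (fst pq) (snd pq)" by simp
  from someI_ex[OF this] show ?thesis by (simp add: pb1_def pb2_def pb_proj_def)
qed

lemma pb_projs:
  assumes "f \<in> hom E X Z" "g \<in> hom E Y Z"
  shows "pb1 E f g \<in> hom E (pb E f g) X" "pb2 E f g \<in> hom E (pb E f g) Y"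
    "f \<cdot> pb1 E f g = g \<cdot> pb2 E f g"
  using pb_is_pullback[OF assms] homD[OF assms(1)] homD[OF assms(2)]
  by (auto simp: is_pullback_def pb_def)

lemma pb_ex1:
  assumes "f \<in> hom E X Z" "g \<in> hom E Y Z" "x \<in> hom E W X" "y \<in> hom E W Y" "f \<cdot> x = g \<cdot> y"
  shows "\<exists>!u. u \<in> hom E W (pb E f g) \<and> pb1 E f g \<cdot> u = x \<and> pb2 E f g \<cdot> u = y"
  using pb_is_pullback[OF assms(1,2)] homD[OF assms(1)] homD[OF assms(2)] assms(3-)
  unfolding is_pullback_def pb_def by metis

lemma pb_pair:
  assumes "f \<in> hom E X Z" "g \<in> hom E Y Z" "x \<in> hom E W X" "y \<in> hom E W Y" "f \<cdot> x = g \<cdot> y"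
  shows "pb_pair E f g x y \<in> hom E W (pb E f g)"
    "pb1 E f g \<cdot> pb_pair E f g x y = x" "pb2 E f g \<cdot> pb_pair E f g x y = y"
  using theI'[OF pb_ex1[OF assms]] homD[OF assms(3)] by (auto simp: pb_pair_def)

lemma pb_pair_eqI:
  assumes "f \<in> hom E X Z" "g \<in> hom E Y Z" "u \<in> hom E W (pb E f g)"
  shows "pb_pair E f g (pb1 E f g \<cdot> u) (pb2 E f g \<cdot> u) = u"
proof -
  note p = pb_projs[OF assms(1,2)]
  have h: "pb1 E f g \<cdot> u \<in> hom E W X" "pb2 E f g \<cdot> u \<in> hom E W Y"
    using p assms(3) Comp_hom by blast+
  moreover have "f \<cdot> (pb1 E f g \<cdot> u) = g \<cdot> (pb2 E f g \<cdot> u)"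
    by (rule square_comp[OF p(3) assms(1) p(1) assms(2) p(2) assms(3)])
  ultimately show ?thesis using pb_ex1[OF assms(1,2) h] pb_pair[OF assms(1,2) h] assms(3) by metis
qed

lemma pb_pair_comp:
  assumes "f \<in> hom E X Z" "g \<in> hom E Y Z" "x \<in> hom E W X" "y \<in> hom E W Y" "f \<cdot> x = g \<cdot> y"
    "h \<in> hom E V W"
  shows "pb_pair E f g x y \<cdot> h = pb_pair E f g (x \<cdot> h) (y \<cdot> h)"
proof -
  note p = pb_projs[OF assms(1,2)] and q = pb_pair[OF assms(1-5)]
  have u: "pb_pair E f g x y \<cdot> h \<in> hom E V (pb E f g)" using q assms Comp_hom by blast
  show ?thesis using pb_pair_eqI[OF assms(1,2) u]
    Comp_assoc[OF p(1) q(1) assms(6)] Comp_assoc[OF p(2) q(1) assms(6)] q by simp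
qed

lemma icatD:
  assumes "is_icat E A"
  shows "ob0 A \<in> Ob E" "ob1 A \<in> Ob E" "isrc A \<in> hom E (ob1 A) (ob0 A)" "itgt A \<in> hom E (ob1 A) (ob0 A)"
    "iid A \<in> hom E (ob0 A) (ob1 A)" "icmp A \<in> hom E (ipairs E A) (ob1 A)"
    "isrc A \<cdot> iid A = Ident E (ob0 A)" "itgt A \<cdot> iid A = Ident E (ob0 A)"
    "isrc A \<cdot> icmp A = isrc A \<cdot> ipair1 E A" "itgt A \<cdot> icmp A = itgt A \<cdot> ipair2 E A"
  using assms by (auto simp: is_icat_def)

lemma icomp:
  assumes A: "is_icat E A" and xy: "x \<in> hom E W (ob1 A)" "y \<in> hom E W (ob1 A)" "itgt A \<cdot> x = isrc A \<cdot> y"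
  shows "icomp E A x y \<in> hom E W (ob1 A)" "isrc A \<cdot> icomp E A x y = isrc A \<cdot> x"
    "itgt A \<cdot> icomp E A x y = itgt A \<cdot> y"
    "h \<in> hom E V W \<Longrightarrow> icomp E A x y \<cdot> h = icomp E A (x \<cdot> h) (y \<cdot> h)"
proof -
  note a = icatD[OF A]
  note p = pb_projs[OF a(4,3)] and q = pb_pair[OF a(4,3) xy]
  show "icomp E A x y \<in> hom E W (ob1 A)" using Comp_hom a q by (simp add: icomp_def)
  show "isrc A \<cdot> icomp E A x y = isrc A \<cdot> x" unfolding icomp_def
    using square_comp[OF a(9,3,6,3) p(1) q(1)] q by simp
  show "itgt A \<cdot> icomp E A x y = itgt A \<cdot> y" unfolding icomp_def
    using square_comp[OF a(10,4,6,4) p(2) q(1)] q by simp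
  show "icomp E A x y \<cdot> h = icomp E A (x \<cdot> h) (y \<cdot> h)" if "h \<in> hom E V W"
    unfolding icomp_def using Comp_assoc[OF a(6) q(1) that] pb_pair_comp[OF a(4,3) xy that] by simp
qed

lemma icomp_unit:
  assumes A: "is_icat E A" and x: "x \<in> hom E W (ob1 A)"
  shows "icomp E A (iid A \<cdot> (isrc A \<cdot> x)) x = x" "icomp E A x (iid A \<cdot> (itgt A \<cdot> x)) = x"
proof -
  note a = icatD[OF A] and i1 = Ident_hom[OF icatD(2)[OF A]]
  have u: "icomp E A (iid A \<cdot> isrc A) (Ident E (ob1 A)) = Ident E (ob1 A)"
    "icomp E A (Ident E (ob1 A)) (iid A \<cdot> itgt A) = Ident E (ob1 A)"
    using A by (auto simp: is_icat_def)
  have h: "iid A \<cdot> isrc A \<in> hom E (ob1 A) (ob1 A)" "iid A \<cdot> itgt A \<in> hom E (ob1 A) (ob1 A)"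
    using a Comp_hom by blast+
  have e: "itgt A \<cdot> (iid A \<cdot> isrc A) = isrc A \<cdot> Ident E (ob1 A)"
    "itgt A \<cdot> Ident E (ob1 A) = isrc A \<cdot> (iid A \<cdot> itgt A)"
    using ident_comp[OF a(8,4,5,3)] ident_comp[OF a(7,3,5,4)] Comp_Ident[OF a(3)] Comp_Ident[OF a(4)]
    by simp_all
  from icomp(4)[OF A h(1) i1 e(1) x] u(1)
  show "icomp E A (iid A \<cdot> (isrc A \<cdot> x)) x = x"
    using Comp_assoc[OF a(5) a(3) x] Ident_Comp[OF x] by simp
  from icomp(4)[OF A i1 h(2) e(2) x] u(2)
  show "icomp E A x (iid A \<cdot> (itgt A \<cdot> x)) = x"
    using Comp_assoc[OF a(5) a(4) x] Ident_Comp[OF x] by simp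
qed

lemma icomp_assoc:
  assumes A: "is_icat E A" and x: "x \<in> hom E W (ob1 A)" and y: "y \<in> hom E W (ob1 A)"
    and z: "z \<in> hom E W (ob1 A)" and xy: "itgt A \<cdot> x = isrc A \<cdot> y" and yz: "itgt A \<cdot> y = isrc A \<cdot> z"
  shows "icomp E A (icomp E A x y) z = icomp E A x (icomp E A y z)"
proof -
  note a = icatD[OF A]
  note p = pb_projs[OF a(4,3)] and q = pb_pair[OF a(4,3) x y xy] and q' = pb_pair[OF a(4,3) y z yz]
  let ?u = "pb_pair E (itgt A) (isrc A) x y" and ?v = "pb_pair E (itgt A) (isrc A) y z"
  let ?r1 = "pb1 E (ipair2 E A) (ipair1 E A)" and ?r2 = "pb2 E (ipair2 E A) (ipair1 E A)"
  have uv: "ipair2 E A \<cdot> ?u = ipair1 E A \<cdot> ?v" using q q' by simp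
  note r = pb_projs[OF p(2,1)] and w = pb_pair[OF p(2,1) q(1) q'(1) uv]
  let ?w = "pb_pair E (ipair2 E A) (ipair1 E A) ?u ?v"
  have as: "icomp E A (icmp A \<cdot> ?r1) (ipair2 E A \<cdot> ?r2) = icomp E A (ipair1 E A \<cdot> ?r1) (icmp A \<cdot> ?r2)"
    using A by (simp add: is_icat_def Let_def)
  have h: "icmp A \<cdot> ?r1 \<in> hom E (pb E (ipair2 E A) (ipair1 E A)) (ob1 A)"
    "ipair2 E A \<cdot> ?r2 \<in> hom E (pb E (ipair2 E A) (ipair1 E A)) (ob1 A)"
    "ipair1 E A \<cdot> ?r1 \<in> hom E (pb E (ipair2 E A) (ipair1 E A)) (ob1 A)"
    "icmp A \<cdot> ?r2 \<in> hom E (pb E (ipair2 E A) (ipair1 E A)) (ob1 A)"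
    using a p r Comp_hom by blast+
  have e1: "itgt A \<cdot> (icmp A \<cdot> ?r1) = isrc A \<cdot> (ipair2 E A \<cdot> ?r2)"
    using square_comp[OF a(10,4,6,4) p(2) r(1)] square_comp[OF p(3) a(4) p(1) a(3) p(2) r(2)] r(3) by simp
  have e2: "itgt A \<cdot> (ipair1 E A \<cdot> ?r1) = isrc A \<cdot> (icmp A \<cdot> ?r2)"
    using square_comp[OF a(9,3,6,3) p(1) r(2)] square_comp[OF p(3) a(4) p(1) a(3) p(2) r(1)] r(3) by simp
  have 1: "icomp E A ((icmp A \<cdot> ?r1) \<cdot> ?w) ((ipair2 E A \<cdot> ?r2) \<cdot> ?w) =
        icomp E A ((ipair1 E A \<cdot> ?r1) \<cdot> ?w) ((icmp A \<cdot> ?r2) \<cdot> ?w)"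
    using icomp(4)[OF A h(1,2) e1 w(1)] icomp(4)[OF A h(3,4) e2 w(1)] as by simp
  have 2: "(icmp A \<cdot> ?r1) \<cdot> ?w = icomp E A x y" "(icmp A \<cdot> ?r2) \<cdot> ?w = icomp E A y z"
    using Comp_assoc[OF a(6) r(1) w(1)] Comp_assoc[OF a(6) r(2) w(1)] w by (simp_all add: icomp_def)
  have 3: "(ipair2 E A \<cdot> ?r2) \<cdot> ?w = z" "(ipair1 E A \<cdot> ?r1) \<cdot> ?w = x"
    using Comp_assoc[OF p(2) r(2) w(1)] Comp_assoc[OF p(1) r(1) w(1)] w q q' by simp_all
  from 1 show ?thesis by (simp add: 2 3)
qed

lemma ifunD:
  assumes "is_ifun E F"
  shows "is_icat E (fdom F)" "is_icat E (fcod F)"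
    "fob F \<in> hom E (ob0 (fdom F)) (ob0 (fcod F))" "far F \<in> hom E (ob1 (fdom F)) (ob1 (fcod F))"
    "isrc (fcod F) \<cdot> far F = fob F \<cdot> isrc (fdom F)"
    "itgt (fcod F) \<cdot> far F = fob F \<cdot> itgt (fdom F)"
    "far F \<cdot> iid (fdom F) = iid (fcod F) \<cdot> fob F"
  using assms by (auto simp: is_ifun_def Let_def)

lemma ifun_at:
  assumes F: "is_ifun E F" and x: "x \<in> hom E W (ob1 (fdom F))"
  shows "far F \<cdot> x \<in> hom E W (ob1 (fcod F))"
    "isrc (fcod F) \<cdot> (far F \<cdot> x) = fob F \<cdot> (isrc (fdom F) \<cdot> x)"
    "itgt (fcod F) \<cdot> (far F \<cdot> x) = fob F \<cdot> (itgt (fdom F) \<cdot> x)"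
proof -
  note f = ifunD[OF F] and a = icatD[OF ifunD(1)[OF F]] and b = icatD[OF ifunD(2)[OF F]]
  show "far F \<cdot> x \<in> hom E W (ob1 (fcod F))" using Comp_hom f x by blast
  show "isrc (fcod F) \<cdot> (far F \<cdot> x) = fob F \<cdot> (isrc (fdom F) \<cdot> x)"
    by (rule square_comp[OF f(5) b(3) f(4) f(3) a(3) x])
  show "itgt (fcod F) \<cdot> (far F \<cdot> x) = fob F \<cdot> (itgt (fdom F) \<cdot> x)"
    by (rule square_comp[OF f(6) b(4) f(4) f(3) a(4) x])
qed

lemma ifun_id_at:
  assumes F: "is_ifun E F" and x: "x \<in> hom E W (ob0 (fdom F))"
  shows "far F \<cdot> (iid (fdom F) \<cdot> x) = iid (fcod F) \<cdot> (fob F \<cdot> x)"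
  by (rule square_comp[OF ifunD(7,4)[OF F] icatD(5)[OF ifunD(1)[OF F]] icatD(5)[OF ifunD(2)[OF F]] ifunD(3)[OF F] x])

lemma ifun_icomp:
  assumes F: "is_ifun E F" and x: "x \<in> hom E W (ob1 (fdom F))" and y: "y \<in> hom E W (ob1 (fdom F))"
    and xy: "itgt (fdom F) \<cdot> x = isrc (fdom F) \<cdot> y"
  shows "far F \<cdot> icomp E (fdom F) x y = icomp E (fcod F) (far F \<cdot> x) (far F \<cdot> y)"
proof -
  let ?A = "fdom F" and ?B = "fcod F"
  note f = ifunD[OF F] and a = icatD[OF ifunD(1)[OF F]] and b = icatD[OF ifunD(2)[OF F]]
  note p = pb_projs[OF a(4,3)] and q = pb_pair[OF a(4,3) x y xy]
  have m: "far F \<cdot> icmp ?A = icomp E ?B (far F \<cdot> ipair1 E ?A) (far F \<cdot> ipair2 E ?A)"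
    using F by (simp add: is_ifun_def Let_def)
  have e: "itgt ?B \<cdot> (far F \<cdot> ipair1 E ?A) = isrc ?B \<cdot> (far F \<cdot> ipair2 E ?A)"
    using ifun_at[OF F p(1)] ifun_at[OF F p(2)] p(3) by simp
  have "far F \<cdot> icomp E ?A x y = (far F \<cdot> icmp ?A) \<cdot> pb_pair E (itgt ?A) (isrc ?A) x y"
    unfolding icomp_def using Comp_assoc[OF f(4) a(6) q(1)] by simp
  also have "\<dots> = icomp E ?B (far F \<cdot> x) (far F \<cdot> y)"
    unfolding m using icomp(4)[OF f(2) ifun_at(1)[OF F p(1)] ifun_at(1)[OF F p(2)] e q(1)]
      Comp_assoc[OF f(4) p(1) q(1)] Comp_assoc[OF f(4) p(2) q(1)] q by simp
  finally show ?thesis .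
qed

lemma ifun_Ident:
  assumes A: "is_icat E A"
  shows "is_ifun E \<lparr>fdom = A, fcod = A, fob = Ident E (ob0 A), far = Ident E (ob1 A)\<rparr>"
proof -
  note a = icatD[OF A]
  note p = pb_projs[OF a(4,3)]
  have "icomp E A (ipair1 E A) (ipair2 E A) = icmp A"
    unfolding icomp_def
    using pb_pair_eqI[OF a(4,3) Ident_hom] Comp_Ident[OF p(1)] Comp_Ident[OF p(2)]
      homD[OF a(6)] Comp_Ident[OF a(6)] by auto
  then show ?thesis
    using A a Ident_hom Comp_Ident[OF a(3)] Comp_Ident[OF a(4)] Ident_Comp[OF a(3)] Ident_Comp[OF a(4)]
      Ident_Comp[OF a(5)] Comp_Ident[OF a(5)] Ident_Comp[OF a(6)] Ident_Comp[OF p(1)] Ident_Comp[OF p(2)]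
    by (simp add: is_ifun_def)
qed

lemma ifun_ifun_comp:
  assumes F: "is_ifun E F" and G: "is_ifun E G" and GF: "fdom G = fcod F"
  shows "is_ifun E (ifun_comp E G F)"
proof -
  note f = ifunD[OF F] and g = ifunD[OF G, unfolded GF]
  note a = icatD[OF f(1)] and b = icatD[OF g(1)] and c = icatD[OF g(2)]
  note p = pb_projs[OF a(4,3)]
  have pp: "icomp E (fdom F) (ipair1 E (fdom F)) (ipair2 E (fdom F)) = icmp (fdom F)"
    unfolding icomp_def
    using pb_pair_eqI[OF a(4,3) Ident_hom] Comp_Ident[OF p(1)] Comp_Ident[OF p(2)]
      homD[OF a(6)] Comp_Ident[OF a(6)] by auto
  have h: "fob G \<cdot> fob F \<in> hom E (ob0 (fdom F)) (ob0 (fcod G))"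
    "far G \<cdot> far F \<in> hom E (ob1 (fdom F)) (ob1 (fcod G))" using f g Comp_hom by blast+
  have 1: "isrc (fcod G) \<cdot> (far G \<cdot> far F) = (fob G \<cdot> fob F) \<cdot> isrc (fdom F)"
    using square_comp[OF g(5) c(3) g(4,3) b(3) f(4)] f(5) Comp_assoc[OF g(3) f(3) a(3)] by simp
  have 3: "itgt (fcod G) \<cdot> (far G \<cdot> far F) = (fob G \<cdot> fob F) \<cdot> itgt (fdom F)"
    using square_comp[OF g(6) c(4) g(4,3) b(4) f(4)] f(6) Comp_assoc[OF g(3) f(3) a(4)] by simp
  have 2: "(far G \<cdot> far F) \<cdot> iid (fdom F) = iid (fcod G) \<cdot> (fob G \<cdot> fob F)"
    using square_comp[OF g(7,4) b(5) c(5) g(3) f(3)] f(7) Comp_assoc[OF g(4) f(4) a(5)] by simp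
  have e: "itgt (fcod F) \<cdot> (far F \<cdot> ipair1 E (fdom F)) = isrc (fcod F) \<cdot> (far F \<cdot> ipair2 E (fdom F))"
    using ifun_at[OF F p(1)] ifun_at[OF F p(2)] p(3) by simp
  have "(far G \<cdot> far F) \<cdot> icmp (fdom F) = far G \<cdot> (far F \<cdot> icmp (fdom F))"
    using Comp_assoc[OF g(4) f(4) a(6)] .
  also have "\<dots> = icomp E (fcod G) (far G \<cdot> (far F \<cdot> ipair1 E (fdom F))) (far G \<cdot> (far F \<cdot> ipair2 E (fdom F)))"
    using ifun_icomp[OF F p] ifun_icomp[OF G, unfolded GF, OF ifun_at(1)[OF F p(1)] ifun_at(1)[OF F p(2)] e] pp
    by simp
  also have "\<dots> = icomp E (fcod G) ((far G \<cdot> far F) \<cdot> ipair1 E (fdom F)) ((far G \<cdot> far F) \<cdot> ipair2 E (fdom F))"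
    using Comp_assoc[OF g(4) f(4) p(1)] Comp_assoc[OF g(4) f(4) p(2)] by simp
  finally show ?thesis using h 1 3 2 f g by (simp add: is_ifun_def ifun_comp_def)
qed

lemma Cat_underlying_category: "category (underlying (Cat E))"
  apply unfold_locales
  subgoal by (auto simp: underlying_def Cat_def cat.truncate_def hom_def ifunD)
  subgoal by (auto simp: underlying_def Cat_def cat.truncate_def hom_def ifunD)
  subgoal by (auto simp: underlying_def Cat_def cat.truncate_def hom_def ifun_Ident)
  subgoal by (auto simp: underlying_def Cat_def cat.truncate_def hom_def ifun_ifun_comp)
     (auto simp: ifun_comp_def)
  subgoal for f X Y using Comp_Ident[of "fob f"] Comp_Ident[of "far f"] ifunD[of f]
    by (auto simp: underlying_def Cat_def cat.truncate_def hom_def ifun_comp_def)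
  subgoal for f X Y using Ident_Comp[of "fob f"] Ident_Comp[of "far f"] ifunD[of f]
    by (auto simp: underlying_def Cat_def cat.truncate_def hom_def ifun_comp_def)
  subgoal for h Y Z g X f W
    using Comp_assoc[of "fob h" "ob0 Y" "ob0 Z" "fob g" "ob0 X" "fob f" "ob0 W"]
     Comp_assoc[of "far h" "ob1 Y" "ob1 Z" "far g" "ob1 X" "far f" "ob1 W"]
     ifunD[of h] ifunD[of g] ifunD[of f]
    by (auto simp: underlying_def Cat_def cat.truncate_def hom_def ifun_comp_def)
  done


lemma inatD:
  assumes "is_inat E \<alpha>"
  shows "is_ifun E (nsrc \<alpha>)" "is_ifun E (ntgt \<alpha>)"
    "fdom (ntgt \<alpha>) = fdom (nsrc \<alpha>)" "fcod (ntgt \<alpha>) = fcod (nsrc \<alpha>)"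
    "ncomp \<alpha> \<in> hom E (ob0 (fdom (nsrc \<alpha>))) (ob1 (fcod (nsrc \<alpha>)))"
    "isrc (fcod (nsrc \<alpha>)) \<cdot> ncomp \<alpha> = fob (nsrc \<alpha>)" "itgt (fcod (nsrc \<alpha>)) \<cdot> ncomp \<alpha> = fob (ntgt \<alpha>)"
  using assms by (auto simp: is_inat_def Let_def)

lemma inat_at:
  assumes \<alpha>: "is_inat E \<alpha>" and x: "x \<in> hom E W (ob0 (fdom (nsrc \<alpha>)))"
  shows "ncomp \<alpha> \<cdot> x \<in> hom E W (ob1 (fcod (nsrc \<alpha>)))"
    "isrc (fcod (nsrc \<alpha>)) \<cdot> (ncomp \<alpha> \<cdot> x) = fob (nsrc \<alpha>) \<cdot> x"
    "itgt (fcod (nsrc \<alpha>)) \<cdot> (ncomp \<alpha> \<cdot> x) = fob (ntgt \<alpha>) \<cdot> x"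
proof -
  note n = inatD[OF \<alpha>] and b = icatD[OF ifunD(2)[OF inatD(1)[OF \<alpha>]]]
  show "ncomp \<alpha> \<cdot> x \<in> hom E W (ob1 (fcod (nsrc \<alpha>)))" using Comp_hom n x by blast
  show "isrc (fcod (nsrc \<alpha>)) \<cdot> (ncomp \<alpha> \<cdot> x) = fob (nsrc \<alpha>) \<cdot> x"
    using Comp_assoc[OF b(3) n(5) x] n by simp
  show "itgt (fcod (nsrc \<alpha>)) \<cdot> (ncomp \<alpha> \<cdot> x) = fob (ntgt \<alpha>) \<cdot> x"
    using Comp_assoc[OF b(4) n(5) x] n by simp
qed

lemma inat_natural:
  assumes \<alpha>: "is_inat E \<alpha>" and x: "x \<in> hom E W (ob1 (fdom (nsrc \<alpha>)))"
  shows "icomp E (fcod (nsrc \<alpha>)) (far (nsrc \<alpha>) \<cdot> x) (ncomp \<alpha> \<cdot> (itgt (fdom (nsrc \<alpha>)) \<cdot> x)) =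
         icomp E (fcod (nsrc \<alpha>)) (ncomp \<alpha> \<cdot> (isrc (fdom (nsrc \<alpha>)) \<cdot> x)) (far (ntgt \<alpha>) \<cdot> x)"
proof -
  note n = inatD[OF \<alpha>]
  note f = ifunD[OF n(1)] and g = ifunD[OF n(2), unfolded n(3,4)]
  note a = icatD[OF f(1)] and b = icatD[OF f(2)]
  note nt = inat_at[OF \<alpha> a(4)] and ns = inat_at[OF \<alpha> a(3)]
  have nat: "icomp E (fcod (nsrc \<alpha>)) (far (nsrc \<alpha>)) (ncomp \<alpha> \<cdot> itgt (fdom (nsrc \<alpha>))) =
         icomp E (fcod (nsrc \<alpha>)) (ncomp \<alpha> \<cdot> isrc (fdom (nsrc \<alpha>))) (far (ntgt \<alpha>))"
    using \<alpha> by (simp add: is_inat_def Let_def)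
  show ?thesis
    using icomp(4)[OF f(2) f(4) nt(1) _ x] icomp(4)[OF f(2) ns(1) g(4) _ x] nat nt ns f(6) g(5)
     Comp_assoc[OF n(5) a(4) x] Comp_assoc[OF n(5) a(3) x] by simp
qed

lemma inat_VIdent:
  assumes F: "is_ifun E F"
  shows "is_inat E \<lparr>nsrc = F, ntgt = F, ncomp = iid (fcod F) \<cdot> fob F\<rparr>"
proof -
  note f = ifunD[OF F]
  note a = icatD[OF f(1)] and b = icatD[OF f(2)]
  have "icomp E (fcod F) (far F) ((iid (fcod F) \<cdot> fob F) \<cdot> itgt (fdom F)) = far F"
    using icomp_unit(2)[OF f(2,4)] f(6) Comp_assoc[OF b(5) f(3) a(4)] by simp
  moreover have "icomp E (fcod F) ((iid (fcod F) \<cdot> fob F) \<cdot> isrc (fdom F)) (far F) = far F"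
    using icomp_unit(1)[OF f(2,4)] f(5) Comp_assoc[OF b(5) f(3) a(3)] by simp
  ultimately show ?thesis
    using F f Comp_hom[OF b(5) f(3)] ident_comp[OF b(7,3,5) f(3)] ident_comp[OF b(8,4,5) f(3)]
    by (simp add: is_inat_def Let_def)
qed

lemma inat_VComp:
  assumes \<alpha>: "is_inat E \<alpha>" and \<beta>: "is_inat E \<beta>" and eq: "nsrc \<beta> = ntgt \<alpha>"
  shows "is_inat E \<lparr>nsrc = nsrc \<alpha>, ntgt = ntgt \<beta>, ncomp = icomp E (fcod (nsrc \<alpha>)) (ncomp \<alpha>) (ncomp \<beta>)\<rparr>"
proof -
  let ?A = "fdom (nsrc \<alpha>)" and ?B = "fcod (nsrc \<alpha>)"
  note n = inatD[OF \<alpha>] 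
  note n' = inatD[OF \<beta>, unfolded eq n(3,4)]
  note f = ifunD[OF n(1)] and g = ifunD[OF n(2), unfolded n(3,4)] and h = ifunD[OF n'(2), unfolded n'(3,4)]
  note a = icatD[OF f(1)] and b = icatD[OF f(2)]
  have e: "itgt ?B \<cdot> ncomp \<alpha> = isrc ?B \<cdot> ncomp \<beta>" using n n' by simp
  note c = icomp[OF f(2) n(5) n'(5) e]
  note nt = inat_at[OF \<alpha> a(4)] and ns = inat_at[OF \<alpha> a(3)]
  note nt' = inat_at[OF \<beta>, unfolded eq n(3,4), OF a(4)] and ns' = inat_at[OF \<beta>, unfolded eq n(3,4), OF a(3)]
  have nat: "icomp E ?B (far (nsrc \<alpha>)) (ncomp \<alpha> \<cdot> itgt ?A) = icomp E ?B (ncomp \<alpha> \<cdot> isrc ?A) (far (ntgt \<alpha>))"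
    using \<alpha> by (simp add: is_inat_def Let_def)
  have nat': "icomp E ?B (far (ntgt \<alpha>)) (ncomp \<beta> \<cdot> itgt ?A) = icomp E ?B (ncomp \<beta> \<cdot> isrc ?A) (far (ntgt \<beta>))"
    using \<beta> n n' eq by (simp add: is_inat_def Let_def)
  have "icomp E ?B (far (nsrc \<alpha>)) (icomp E ?B (ncomp \<alpha>) (ncomp \<beta>) \<cdot> itgt ?A)
      = icomp E ?B (far (nsrc \<alpha>)) (icomp E ?B (ncomp \<alpha> \<cdot> itgt ?A) (ncomp \<beta> \<cdot> itgt ?A))"
    using c(4)[OF a(4)] by simp
  also have "\<dots> = icomp E ?B (icomp E ?B (far (nsrc \<alpha>)) (ncomp \<alpha> \<cdot> itgt ?A)) (ncomp \<beta> \<cdot> itgt ?A)"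
    using icomp_assoc[OF f(2) f(4) nt(1) nt'(1)] f nt nt' by simp
  also have "\<dots> = icomp E ?B (ncomp \<alpha> \<cdot> isrc ?A) (icomp E ?B (far (ntgt \<alpha>)) (ncomp \<beta> \<cdot> itgt ?A))"
    using icomp_assoc[OF f(2) ns(1) g(4) nt'(1)] g ns nt' nat by simp
  also have "\<dots> = icomp E ?B (icomp E ?B (ncomp \<alpha> \<cdot> isrc ?A) (ncomp \<beta> \<cdot> isrc ?A)) (far (ntgt \<beta>))"
    using icomp_assoc[OF f(2) ns(1) ns'(1) h(4)] h ns ns' nat' by simp
  also have "\<dots> = icomp E ?B (icomp E ?B (ncomp \<alpha>) (ncomp \<beta>) \<cdot> isrc ?A) (far (ntgt \<beta>))"
    using c(4)[OF a(3)] by simp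
  finally show ?thesis using n n' c by (simp add: is_inat_def Let_def)
qed

lemma inat_whisker_left:
  assumes \<alpha>: "is_inat E \<alpha>" and G: "is_ifun E G" and GF: "fdom G = fcod (nsrc \<alpha>)"
  shows "is_inat E \<lparr>nsrc = ifun_comp E G (nsrc \<alpha>), ntgt = ifun_comp E G (ntgt \<alpha>), ncomp = far G \<cdot> ncomp \<alpha>\<rparr>"
proof -
  let ?A = "fdom (nsrc \<alpha>)" and ?B = "fcod (nsrc \<alpha>)" and ?C = "fcod G"
  note n = inatD[OF \<alpha>] 
  note f = ifunD[OF n(1)] and f' = ifunD[OF n(2), unfolded n(3,4)] and g = ifunD[OF G, unfolded GF]
  note a = icatD[OF f(1)] and b = icatD[OF f(2)] and c = icatD[OF g(2)]
  note nt = inat_at[OF \<alpha> a(4)] and ns = inat_at[OF \<alpha> a(3)]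
  have nat: "icomp E ?B (far (nsrc \<alpha>)) (ncomp \<alpha> \<cdot> itgt ?A) = icomp E ?B (ncomp \<alpha> \<cdot> isrc ?A) (far (ntgt \<alpha>))"
    using \<alpha> by (simp add: is_inat_def Let_def)
  have "icomp E ?C (far G \<cdot> far (nsrc \<alpha>)) (far G \<cdot> (ncomp \<alpha> \<cdot> itgt ?A)) = 
        icomp E ?C (far G \<cdot> (ncomp \<alpha> \<cdot> isrc ?A)) (far G \<cdot> far (ntgt \<alpha>))"
    using ifun_icomp[OF G, unfolded GF, OF f(4) nt(1)] ifun_icomp[OF G, unfolded GF, OF ns(1) f'(4)]
      nat f f' nt ns by simp
  moreover note ifun_at[OF G, unfolded GF, OF n(5)]
  moreover have "is_ifun E (ifun_comp E G (nsrc \<alpha>))" "is_ifun E (ifun_comp E G (ntgt \<alpha>))"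
    using ifun_ifun_comp G GF n by auto
  ultimately show ?thesis
    using n Comp_assoc[OF g(4) n(5) a(3)] Comp_assoc[OF g(4) n(5) a(4)]
    by (simp add: is_inat_def Let_def ifun_comp_def)
qed

lemma inat_whisker_right:
  assumes \<beta>: "is_inat E \<beta>" and F: "is_ifun E F" and GF: "fdom (nsrc \<beta>) = fcod F"
  shows "is_inat E \<lparr>nsrc = ifun_comp E (nsrc \<beta>) F, ntgt = ifun_comp E (ntgt \<beta>) F, ncomp = ncomp \<beta> \<cdot> fob F\<rparr>"
proof -
  note n = inatD[OF \<beta>, unfolded GF] and f = ifunD[OF F]
  note a = icatD[OF f(1)]
  note x = inat_at[OF \<beta>, unfolded GF, OF f(3)] and y = inat_natural[OF \<beta>, unfolded GF, OF f(4)]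
  moreover have "is_ifun E (ifun_comp E (nsrc \<beta>) F)" "is_ifun E (ifun_comp E (ntgt \<beta>) F)"
    using ifun_ifun_comp F GF n by auto
  ultimately show ?thesis
    using n f(5,6) Comp_assoc[OF n(5) f(3) a(3)] Comp_assoc[OF n(5) f(3) a(4)]
    by (simp add: is_inat_def Let_def ifun_comp_def)
qed

lemma inat_HComp:
  assumes \<alpha>: "is_inat E \<alpha>" and \<beta>: "is_inat E \<beta>" and eq: "fdom (nsrc \<beta>) = fcod (nsrc \<alpha>)"
  shows "is_inat E \<lparr>nsrc = ifun_comp E (nsrc \<beta>) (nsrc \<alpha>), ntgt = ifun_comp E (ntgt \<beta>) (ntgt \<alpha>),
         ncomp = icomp E (fcod (nsrc \<beta>))
           (far (nsrc \<beta>) \<cdot> ncomp \<alpha>) (ncomp \<beta> \<cdot> fob (ntgt \<alpha>))\<rparr>"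
  using inat_VComp[OF inat_whisker_left[OF \<alpha> inatD(1)[OF \<beta>] eq] inat_whisker_right[OF \<beta> inatD(2)[OF \<alpha>]]]
    eq inatD[OF \<alpha>] by (simp add: ifun_comp_def)

lemma Cat_simps:
  "Ob (Cat E) = {A. is_icat E A}" "Ar (Cat E) = {F. is_ifun E F}" "Dom (Cat E) = fdom" "Cod (Cat E) = fcod"
  "Comp (Cat E) = ifun_comp E" "Cell (Cat E) = {\<alpha>. is_inat E \<alpha>}" "Src (Cat E) = nsrc" "Tgt (Cat E) = ntgt"
  "F \<in> hom (Cat E) A B \<longleftrightarrow> is_ifun E F \<and> fdom F = A \<and> fcod F = B"
  "\<alpha> \<in> cells (Cat E) F G \<longleftrightarrow> is_inat E \<alpha> \<and> nsrc \<alpha> = F \<and> ntgt \<alpha> = G"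
  by (auto simp: Cat_def hom_def cells_def)

theorem Cat_two_category: "two_category (Cat E)"
proof (rule two_category.intro)
  show "category (underlying (Cat E))" by (rule Cat_underlying_category)
next
  fix \<alpha> assume "\<alpha> \<in> Cell (Cat E)"
  then show "Src (Cat E) \<alpha> \<in> Ar (Cat E) \<and>
      Tgt (Cat E) \<alpha> \<in> hom (Cat E) (Dom (Cat E) (Src (Cat E) \<alpha>)) (Cod (Cat E) (Src (Cat E) \<alpha>))"
    using inatD[of \<alpha>] by (simp add: Cat_simps)
next
  fix F assume "F \<in> Ar (Cat E)"
  then show "VIdent (Cat E) F \<in> cells (Cat E) F F"
    using inat_VIdent[of F] by (simp add: Cat_simps) (simp add: Cat_def)
next
  fix \<beta> G H \<alpha> F assume "\<beta> \<in> cells (Cat E) G H" "\<alpha> \<in> cells (Cat E) F G"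
  then show "VComp (Cat E) \<beta> \<alpha> \<in> cells (Cat E) F H"
    using inat_VComp[of \<alpha> \<beta>] by (simp add: Cat_simps) (simp add: Cat_def)
next
  fix \<beta> G G' \<alpha> F F'
  assume "\<beta> \<in> cells (Cat E) G G'" "\<alpha> \<in> cells (Cat E) F F'" "Dom (Cat E) G = Cod (Cat E) F"
  then show "HComp (Cat E) \<beta> \<alpha> \<in> cells (Cat E) (G \<cdot>\<^bsub>Cat E\<^esub> F) (G' \<cdot>\<^bsub>Cat E\<^esub> F')"
    using inat_HComp[of \<alpha> \<beta>] by (simp add: Cat_simps) (auto simp: Cat_def)
next
  fix \<alpha> F G assume h: "\<alpha> \<in> cells (Cat E) F G"
  then have \<alpha>: "is_inat E \<alpha>" by (simp add: Cat_simps)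
  note n = inatD[OF \<alpha>]
  note f = ifunD[OF n(1)] and g = ifunD[OF n(2), unfolded n(3,4)]
  show "VComp (Cat E) \<alpha> (VIdent (Cat E) F) = \<alpha>"
    using h icomp_unit(1)[OF f(2) n(5)] n by (simp add: Cat_simps) (auto simp: Cat_def)
  show "VComp (Cat E) (VIdent (Cat E) G) \<alpha> = \<alpha>"
    using h icomp_unit(2)[OF f(2) n(5)] n by (simp add: Cat_simps) (auto simp: Cat_def)
  show "HComp (Cat E) \<alpha> (VIdent (Cat E) (Ident (Cat E) (Dom (Cat E) F))) = \<alpha>"
    using h icomp_unit(1)[OF f(2) n(5)] n Comp_Ident[OF f(3)] Comp_Ident[OF f(4)] Comp_Ident[OF g(3)] Comp_Ident[OF g(4)]
      Comp_Ident[OF n(5)] f(7) Comp_Ident[OF icatD(5)[OF f(1)]]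
    by (simp add: Cat_simps) (auto simp: Cat_def ifun_comp_def)
  show "HComp (Cat E) (VIdent (Cat E) (Ident (Cat E) (Cod (Cat E) F))) \<alpha> = \<alpha>"
    using h icomp_unit(2)[OF f(2) n(5)] n Ident_Comp[OF f(3)] Ident_Comp[OF f(4)] Ident_Comp[OF g(3)] Ident_Comp[OF g(4)]
      Ident_Comp[OF n(5)] Comp_Ident[OF icatD(5)[OF f(2)]]
    by (simp add: Cat_simps) (auto simp: Cat_def ifun_comp_def)
next
  fix \<gamma> H K \<beta> G \<alpha> F
  assume h: "\<gamma> \<in> cells (Cat E) H K" "\<beta> \<in> cells (Cat E) G H" "\<alpha> \<in> cells (Cat E) F G"
  then have i: "is_inat E \<alpha>" "is_inat E \<beta>" "is_inat E \<gamma>" by (simp_all add: Cat_simps)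
  note n = inatD[OF i(1)] inatD[OF i(2)] inatD[OF i(3)]
  show "VComp (Cat E) (VComp (Cat E) \<gamma> \<beta>) \<alpha> = VComp (Cat E) \<gamma> (VComp (Cat E) \<beta> \<alpha>)"
    using h n icomp_assoc[of "fcod F" "ncomp \<alpha>" _ "ncomp \<beta>" "ncomp \<gamma>"] ifunD(2)[OF n(1)]
    by (simp add: Cat_simps) (auto simp: Cat_def)
next
  fix \<gamma> H H' \<beta> G G' \<alpha> F F'
  assume h: "\<gamma> \<in> cells (Cat E) H H'" "\<beta> \<in> cells (Cat E) G G'" "\<alpha> \<in> cells (Cat E) F F'"
    and d: "Dom (Cat E) H = Cod (Cat E) G" "Dom (Cat E) G = Cod (Cat E) F"
  then have i: "is_inat E \<alpha>" "is_inat E \<beta>" "is_inat E \<gamma>" by (simp_all add: Cat_simps)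
  have s: "nsrc \<alpha> = F" "ntgt \<alpha> = F'" "nsrc \<beta> = G" "ntgt \<beta> = G'" "nsrc \<gamma> = H" "ntgt \<gamma> = H'"
    using h by (simp_all add: Cat_simps)
  have d: "fdom H = fcod G" "fdom G = fcod F" using d by (simp_all add: Cat_simps)
  note n = inatD[OF i(1), unfolded s] and n' = inatD[OF i(2), unfolded s d] and n'' = inatD[OF i(3), unfolded s d]
  note f = ifunD[OF n(1)] and f' = ifunD[OF n(2), unfolded n(3,4)]
    and g = ifunD[OF n'(1), unfolded d] and g' = ifunD[OF n'(2), unfolded n'(3,4)]
    and k = ifunD[OF n''(1), unfolded d] and k' = ifunD[OF n''(2), unfolded n''(3,4)]
  have ob: "(fob H \<cdot> fob G) \<cdot> fob F = fob H \<cdot> (fob G \<cdot> fob F)" 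
      "(fob H' \<cdot> fob G') \<cdot> fob F' = fob H' \<cdot> (fob G' \<cdot> fob F')"
      "(far H \<cdot> far G) \<cdot> far F = far H \<cdot> (far G \<cdot> far F)" 
      "(far H' \<cdot> far G') \<cdot> far F' = far H' \<cdot> (far G' \<cdot> far F')"
    using Comp_assoc[OF k(3) g(3) f(3)] Comp_assoc[OF k(4) g(4) f(4)]
     Comp_assoc[OF k'(3) g'(3) f'(3)] Comp_assoc[OF k'(4) g'(4) f'(4)] by simp_all
  let ?D = "fcod H"
  let ?x = "far H \<cdot> (far G \<cdot> ncomp \<alpha>)" and ?y = "far H \<cdot> (ncomp \<beta> \<cdot> fob F')" and ?z = "ncomp \<gamma> \<cdot> (fob G' \<cdot> fob F')"
  note ga = ifun_at[OF n'(1), unfolded d, OF n(5)]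
  note bf = inat_at[OF i(2), unfolded s d, OF f'(3)]
  note hga = ifun_at[OF n''(1), unfolded d, OF ga(1)] and hbf = ifun_at[OF n''(1), unfolded d, OF bf(1)]
  note hb = ifun_at[OF n''(1), unfolded d, OF n'(5)]
  note cg = inat_at[OF i(3), unfolded s d, OF g'(3)]
  note cgf = inat_at[OF i(3), unfolded s d, OF Comp_hom[OF g'(3) f'(3)]]
  have 1: "icomp E ?D (far H \<cdot> ncomp \<beta>) (ncomp \<gamma> \<cdot> fob G') \<cdot> fob F' = icomp E ?D ?y ?z"
    using icomp(4)[OF k(2) hb(1) cg(1) _ f'(3)] hb cg n' Comp_assoc[OF k(4) n'(5) f'(3)] Comp_assoc[OF n''(5) g'(3) f'(3)]
    by simp
  have 2: "far H \<cdot> icomp E (fcod G) (far G \<cdot> ncomp \<alpha>) (ncomp \<beta> \<cdot> fob F') = icomp E ?D ?x ?y"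
    using ifun_icomp[OF n''(1), unfolded d, OF ga(1) bf(1)] ga bf n by simp
  have 3: "icomp E ?D (icomp E ?D ?x ?y) ?z = icomp E ?D ?x (icomp E ?D ?y ?z)"
    using icomp_assoc[OF k(2) hga(1) hbf(1) cgf(1)] hga hbf cgf ga bf n by simp
  have 4: "(far H \<cdot> far G) \<cdot> ncomp \<alpha> = ?x" using Comp_assoc[OF k(4) g(4) n(5)] .
  show "HComp (Cat E) (HComp (Cat E) \<gamma> \<beta>) \<alpha> = HComp (Cat E) \<gamma> (HComp (Cat E) \<beta> \<alpha>)"
    using 1 2 3 4 ob by (simp add: Cat_def ifun_comp_def s)
next
  fix \<beta> G G' \<beta>' G'' \<alpha> F F' \<alpha>' F''
  assume h: "\<beta> \<in> cells (Cat E) G G'" "\<beta>' \<in> cells (Cat E) G' G''" 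
     "\<alpha> \<in> cells (Cat E) F F'" "\<alpha>' \<in> cells (Cat E) F' F''"
    and d: "Dom (Cat E) G = Cod (Cat E) F"
  then have i: "is_inat E \<alpha>" "is_inat E \<alpha>'" "is_inat E \<beta>" "is_inat E \<beta>'" by (simp_all add: Cat_simps)
  have s: "nsrc \<alpha> = F" "ntgt \<alpha> = F'" "nsrc \<alpha>' = F'" "ntgt \<alpha>' = F''"
      "nsrc \<beta> = G" "ntgt \<beta> = G'" "nsrc \<beta>' = G'" "ntgt \<beta>' = G''"
    using h by (simp_all add: Cat_simps)
  have d: "fdom G = fcod F" using d by (simp_all add: Cat_simps)
  note na = inatD[OF i(1), unfolded s] and nb = inatD[OF i(3), unfolded s d]
  note na' = inatD[OF i(2), unfolded s na(3,4)] and nb' = inatD[OF i(4), unfolded s nb(3,4)]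
  note f = ifunD[OF na(1)] and f' = ifunD[OF na(2), unfolded na(3,4)] and f'' = ifunD[OF na'(2), unfolded na'(3,4)]
    and g = ifunD[OF nb(1), unfolded d] and g' = ifunD[OF nb(2), unfolded nb(3,4)]
  let ?C = "fcod G"
  note x = ifun_at[OF nb(1), unfolded d, OF na(5)] and x' = ifun_at[OF nb(1), unfolded d, OF na'(5)]
   and x'' = ifun_at[OF nb(2), unfolded nb(3,4), OF na'(5)]
   and y = inat_at[OF i(3), unfolded s d, OF f'(3)] and y' = inat_at[OF i(3), unfolded s d, OF f''(3)]
   and z = inat_at[OF i(4), unfolded s nb(3,4), OF f''(3)]
  have 1: "far G \<cdot> icomp E (fcod F) (ncomp \<alpha>) (ncomp \<alpha>') = icomp E ?C (far G \<cdot> ncomp \<alpha>) (far G \<cdot> ncomp \<alpha>')"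
    using ifun_icomp[OF nb(1), unfolded d, OF na(5) na'(5)] na na' by simp
  have 2: "icomp E ?C (ncomp \<beta>) (ncomp \<beta>') \<cdot> fob F'' = icomp E ?C (ncomp \<beta> \<cdot> fob F'') (ncomp \<beta>' \<cdot> fob F'')"
    using icomp(4)[OF g(2) nb(5) nb'(5) _ f''(3)] nb nb' by simp
  have 3: "icomp E ?C (far G \<cdot> ncomp \<alpha>') (ncomp \<beta> \<cdot> fob F'') = icomp E ?C (ncomp \<beta> \<cdot> fob F') (far G' \<cdot> ncomp \<alpha>')"
    using inat_natural[OF i(3), unfolded s d, OF na'(5)] na' by simp
  have e: "itgt ?C \<cdot> (far G \<cdot> ncomp \<alpha>) = isrc ?C \<cdot> (far G \<cdot> ncomp \<alpha>')"
    "itgt ?C \<cdot> (far G \<cdot> ncomp \<alpha>') = isrc ?C \<cdot> (ncomp \<beta> \<cdot> fob F'')"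
    "itgt ?C \<cdot> (ncomp \<beta> \<cdot> fob F'') = isrc ?C \<cdot> (ncomp \<beta>' \<cdot> fob F'')"
    "itgt ?C \<cdot> (far G \<cdot> ncomp \<alpha>) = isrc ?C \<cdot> (ncomp \<beta> \<cdot> fob F')"
    "itgt ?C \<cdot> (ncomp \<beta> \<cdot> fob F') = isrc ?C \<cdot> (far G' \<cdot> ncomp \<alpha>')"
    "itgt ?C \<cdot> (far G' \<cdot> ncomp \<alpha>') = isrc ?C \<cdot> (ncomp \<beta>' \<cdot> fob F'')"
    using x x' x'' y y' z na na' nb by simp_all
  note c1 = icomp[OF g(2) y'(1) z(1) e(3)] and c2 = icomp[OF g(2) x''(1) z(1) e(6)]
  have "icomp E ?C (icomp E ?C (far G \<cdot> ncomp \<alpha>) (far G \<cdot> ncomp \<alpha>')) (icomp E ?C (ncomp \<beta> \<cdot> fob F'') (ncomp \<beta>' \<cdot> fob F''))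
     = icomp E ?C (far G \<cdot> ncomp \<alpha>) (icomp E ?C (far G \<cdot> ncomp \<alpha>') (icomp E ?C (ncomp \<beta> \<cdot> fob F'') (ncomp \<beta>' \<cdot> fob F'')))"
    using icomp_assoc[OF g(2) x(1) x'(1) c1(1) e(1)] c1 e by simp
  also have "\<dots> = icomp E ?C (far G \<cdot> ncomp \<alpha>) (icomp E ?C (icomp E ?C (far G \<cdot> ncomp \<alpha>') (ncomp \<beta> \<cdot> fob F'')) (ncomp \<beta>' \<cdot> fob F''))"
    using icomp_assoc[OF g(2) x'(1) y'(1) z(1) e(2,3)] by simp
  also have "\<dots> = icomp E ?C (far G \<cdot> ncomp \<alpha>) (icomp E ?C (ncomp \<beta> \<cdot> fob F') (icomp E ?C (far G' \<cdot> ncomp \<alpha>') (ncomp \<beta>' \<cdot> fob F'')))"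
    using icomp_assoc[OF g(2) y(1) x''(1) z(1) e(5,6)] 3 by simp
  also have "\<dots> = icomp E ?C (icomp E ?C (far G \<cdot> ncomp \<alpha>) (ncomp \<beta> \<cdot> fob F')) (icomp E ?C (far G' \<cdot> ncomp \<alpha>') (ncomp \<beta>' \<cdot> fob F''))"
    using icomp_assoc[OF g(2) x(1) y(1) c2(1) e(4)] c2 e by simp
  finally show "HComp (Cat E) (VComp (Cat E) \<beta>' \<beta>) (VComp (Cat E) \<alpha>' \<alpha>) =
      VComp (Cat E) (HComp (Cat E) \<beta>' \<alpha>') (HComp (Cat E) \<beta> \<alpha>)"
    using 1 2 nb(4) na(4) by (simp add: Cat_def s ifun_comp_def)
next
  fix G F assume h: "G \<in> Ar (Cat E)" "F \<in> Ar (Cat E)" and d: "Dom (Cat E) G = Cod (Cat E) F"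
  then have d: "fdom G = fcod F" and i: "is_ifun E G" "is_ifun E F" by (simp_all add: Cat_simps)
  note f = ifunD[OF i(2)] and g = ifunD[OF i(1), unfolded d]
  note b = icatD[OF f(2)] and c = icatD[OF g(2)]
  note gf = Comp_hom[OF g(3) f(3)] 
  note x = Comp_hom[OF c(5) gf]
  have e: "isrc (fcod G) \<cdot> (iid (fcod G) \<cdot> (fob G \<cdot> fob F)) = fob G \<cdot> fob F"
    using ident_comp[OF c(7,3,5) gf] .
  show "HComp (Cat E) (VIdent (Cat E) G) (VIdent (Cat E) F) = VIdent (Cat E) (G \<cdot>\<^bsub>Cat E\<^esub> F)"
    using icomp_unit(1)[OF g(2) x] ifun_id_at[OF i(1), unfolded d, OF f(3)] Comp_assoc[OF c(5) g(3) f(3)] e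
    by (simp add: Cat_def ifun_comp_def)
qed

lemma is_icat_disc:
  assumes X: "X \<in> Ob E"
  shows "is_icat E (disc_icat E X)"
proof -
  let ?i = "Ident E X"
  note i = Ident_hom[OF X]
  note p = pb_projs[OF i i]
  have e: "pb1 E ?i ?i = pb2 E ?i ?i" using p Ident_Comp[OF p(1)] Ident_Comp[OF p(2)] by simp
  have ic: "icomp E (disc_icat E X) x y = y" if "x \<in> hom E W X" "y \<in> hom E W X" "x = y" for x y W
    using pb_pair[OF i i that(1,2)] that by (simp add: icomp_def disc_icat_def)
  note r = pb_projs[OF p(2,1)]
  have ii: "?i \<cdot> ?i = ?i" using Ident_Comp[OF i] .
  have c: "pb2 E ?i ?i \<cdot> pb1 E (pb2 E ?i ?i) (pb2 E ?i ?i) \<in> hom E (pb E (pb2 E ?i ?i) (pb2 E ?i ?i)) X"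
     "pb2 E ?i ?i \<cdot> pb2 E (pb2 E ?i ?i) (pb2 E ?i ?i) \<in> hom E (pb E (pb2 E ?i ?i) (pb2 E ?i ?i)) X"
    using r p e Comp_hom by metis+
  show ?thesis
    using X i p ii e r c ic[OF i i] ic[OF c(1) c(2)] Ident_Comp[OF p(1)] Ident_Comp[OF p(2)]
    by (simp add: is_icat_def Let_def) (simp add: disc_icat_def)
qed

lemma is_functor_disc: "is_functor E (underlying (Cat E)) (disc E)"
proof -
  have ic: "icomp E (disc_icat E X) x y = y" if "X \<in> Ob E" "x \<in> hom E W X" "y \<in> hom E W X" "x = y" for X x y W
    using pb_pair[OF Ident_hom Ident_hom that(2,3)] that by (simp add: icomp_def disc_icat_def)
  have "is_ifun E (Far (disc E) f)" if f: "f \<in> hom E X Y" for f X Y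
  proof -
    note h = homD[OF f]
    have X: "X \<in> Ob E" and Y: "Y \<in> Ob E" using h by auto
    note p = pb_projs[OF Ident_hom[OF X] Ident_hom[OF X]]
    have e: "pb1 E (Ident E X) (Ident E X) = pb2 E (Ident E X) (Ident E X)"
      using p Ident_Comp[OF p(1)] Ident_Comp[OF p(2)] by simp
    show ?thesis
      using h is_icat_disc[OF X] is_icat_disc[OF Y] f Ident_Comp[OF f] Comp_Ident[OF f] e p
        ic[OF Y Comp_hom[OF f p(2)] Comp_hom[OF f p(2)]]
      by (simp add: disc_def is_ifun_def) (simp add: disc_icat_def)
  qed
  note F = this[OF homI]
  show ?thesis
    unfolding is_functor_def
  proof (intro conjI ballI impI)
    fix X assume X: "X \<in> Ob E"
    show "Fob (disc E) X \<in> Ob (underlying (Cat E))"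
      using is_icat_disc[OF X] by (simp add: underlying_def cat.truncate_def Cat_simps disc_def)
    show "Far (disc E) (Ident E X) = Ident (underlying (Cat E)) (Fob (disc E) X)"
      using homD[OF Ident_hom[OF X]] 
      by (simp add: underlying_def cat.truncate_def Cat_def disc_def disc_icat_def)
  next
    fix f assume f: "f \<in> Ar E"
    show "Far (disc E) f \<in> hom (underlying (Cat E)) (Fob (disc E) (Dom E f)) (Fob (disc E) (Cod E f))"
      using F[OF f] by (simp add: underlying_def cat.truncate_def Cat_simps hom_def) (simp add: disc_def)
    fix g assume g: "g \<in> Ar E" "Dom E g = Cod E f"
    show "Far (disc E) (g \<cdot> f) = Far (disc E) g \<cdot>\<^bsub>underlying (Cat E)\<^esub> Far (disc E) f"
      using homD[OF Comp_hom[OF homI[OF g(1), unfolded g(2)] homI[OF f]]] 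
      by (simp add: underlying_def cat.truncate_def Cat_def disc_def ifun_comp_def)
  qed
qed

lemma is_functor_objs: "is_functor (underlying (Cat E)) E objs"
  unfolding is_functor_def
  by (auto simp: underlying_def cat.truncate_def Cat_def objs_def ifun_comp_def icatD ifunD)

lemma is_functor_Pi0:
  assumes "has_reflexive_coequalisers E"
  shows "is_functor (underlying (Cat E)) E (Pi0 E)"
proof -
  define q where "q A = coeq E (isrc A) (itgt A)" for A :: "('o, 'a) icat"
  have q: "is_coequaliser E (isrc A) (itgt A) (q A)" if A: "is_icat E A" for A
  proof -
    note a = icatD[OF A]
    have "reflexive_pair E (isrc A) (itgt A)"
      unfolding reflexive_pair_def using a homD[OF a(3)] homD[OF a(4)] by (auto intro!: bexI[of _ "iid A"])
    then show ?thesis unfolding q_def coeq_def using assms has_reflexive_coequalisers_def someI_ex by metis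
  qed
  have qh: "q A \<in> hom E (ob0 A) (Cod E (q A))" "q A \<cdot> isrc A = q A \<cdot> itgt A" if "is_icat E A" for A
    using q[OF that] homD[OF icatD(3)[OF that]] by (auto simp: is_coequaliser_def)
  have u1: "\<exists>!u. u \<in> hom E (Cod E (q A)) X \<and> u \<cdot> q A = x"
    if "is_icat E A" "x \<in> hom E (ob0 A) X" "x \<cdot> isrc A = x \<cdot> itgt A" for A x X
    using q[OF that(1)] that homD[OF icatD(3)[OF that(1)]] by (auto simp: is_coequaliser_def)
  have P: "Fob (Pi0 E) A = Cod E (q A)"
    "Far (Pi0 E) F = (THE u. u \<in> hom E (Cod E (q (fdom F))) (Cod E (q (fcod F))) \<and> u \<cdot> q (fdom F) = q (fcod F) \<cdot> fob F)"
    for A F by (simp_all add: Pi0_def q_def Let_def)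
  have ex: "\<exists>!u. u \<in> hom E (Cod E (q (fdom F))) (Cod E (q (fcod F))) \<and> u \<cdot> q (fdom F) = q (fcod F) \<cdot> fob F"
    if F: "is_ifun E F" for F
  proof (rule u1)
    note f = ifunD[OF F]
    note a = icatD[OF f(1)] and b = icatD[OF f(2)]
    show "is_icat E (fdom F)" by fact
    show "q (fcod F) \<cdot> fob F \<in> hom E (ob0 (fdom F)) (Cod E (q (fcod F)))"
      using Comp_hom qh(1)[OF f(2)] f(3) .
    show "(q (fcod F) \<cdot> fob F) \<cdot> isrc (fdom F) = (q (fcod F) \<cdot> fob F) \<cdot> itgt (fdom F)"
      using Comp_assoc[OF qh(1)[OF f(2)] f(3) a(3)] Comp_assoc[OF qh(1)[OF f(2)] f(3) a(4)] f(5,6)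
       square_comp[OF qh(2)[OF f(2)] qh(1)[OF f(2)] b(3) qh(1)[OF f(2)] b(4) f(4)] by simp
  qed
  have Pu: "Far (Pi0 E) F = u" if "is_ifun E F" "u \<in> hom E (Cod E (q (fdom F))) (Cod E (q (fcod F)))"
     "u \<cdot> q (fdom F) = q (fcod F) \<cdot> fob F" for F u
    unfolding P using the1_equality[OF ex[OF that(1)]] that by blast
  have Ph: "Far (Pi0 E) F \<in> hom E (Cod E (q (fdom F))) (Cod E (q (fcod F)))"
     "Far (Pi0 E) F \<cdot> q (fdom F) = q (fcod F) \<cdot> fob F" if "is_ifun E F" for F
    unfolding P using theI'[OF ex[OF that]] by auto
  show ?thesis
    unfolding is_functor_def
  proof (intro conjI ballI impI)
    fix A assume "A \<in> Ob (underlying (Cat E))"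
    then have A: "is_icat E A" by (simp add: underlying_def cat.truncate_def Cat_simps)
    show "Fob (Pi0 E) A \<in> Ob E" using homD[OF qh(1)[OF A]] by (simp add: P)
    then show "Far (Pi0 E) (Ident (underlying (Cat E)) A) = Ident E (Fob (Pi0 E) A)"
      using Pu[OF ifun_Ident[OF A]] Ident_Comp[OF qh(1)[OF A]] Comp_Ident[OF qh(1)[OF A]] Ident_hom
      by (simp add: underlying_def cat.truncate_def Cat_def P(1))
  next
    fix F assume "F \<in> Ar (underlying (Cat E))"
    then have F: "is_ifun E F" by (simp add: underlying_def cat.truncate_def Cat_simps)
    then show "Far (Pi0 E) F \<in> hom E (Fob (Pi0 E) (Dom (underlying (Cat E)) F)) (Fob (Pi0 E) (Cod (underlying (Cat E)) F))"
      using Ph(1) by (simp add: underlying_def cat.truncate_def Cat_simps P(1))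
    fix G assume "G \<in> Ar (underlying (Cat E))" "Dom (underlying (Cat E)) G = Cod (underlying (Cat E)) F"
    then have G: "is_ifun E G" and d: "fdom G = fcod F" by (simp_all add: underlying_def cat.truncate_def Cat_simps)
    note f = ifunD[OF F] and g = ifunD[OF G, unfolded d]
    note PF = Ph[OF F] and PG = Ph[OF G, unfolded d]
    have "Far (Pi0 E) (ifun_comp E G F) = Far (Pi0 E) G \<cdot> Far (Pi0 E) F"
      using Pu[OF ifun_ifun_comp[OF F G d]] Comp_hom[OF PG(1) PF(1)] PF(2)
        Comp_assoc[OF PG(1) PF(1) qh(1)[OF f(1)]] Comp_assoc[OF qh(1)[OF g(2)] g(3) f(3)]
        square_comp[OF PG(2,1) qh(1)[OF f(2)] qh(1)[OF g(2)] g(3) f(3)]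
      by (simp add: ifun_comp_def)
    then show "Far (Pi0 E) (G \<cdot>\<^bsub>underlying (Cat E)\<^esub> F) = Far (Pi0 E) G \<cdot> Far (Pi0 E) F"
      by (simp add: underlying_def cat.truncate_def Cat_simps)
  qed
qed

end

end

theory Submission
  imports Defs
begin

text \<open>Internal functors \<open>disc X \<rightarrow> A\<close> correspond to arrows \<open>X \<rightarrow> A\<^sub>0\<close>, and natural
  transformations between them to arrows \<open>X \<rightarrow> A\<^sub>1\<close>. Hence both the one- and the two-dimensional
  universal property of \<open>disc N\<close> are instances of the universal property of \<open>N\<close>, with targets
  \<open>A\<^sub>0\<close> and \<open>A\<^sub>1\<close> respectively. Conversely, internal functors from \<open>A\<close> to the codiscrete category
  on \<open>X\<close> correspond to arrows \<open>A\<^sub>0 \<rightarrow> X\<close>, so the object of objects of a natural numbers object in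
  \<open>Cat(E)\<close> is one in \<open>E\<close>. Finally, comparing a natural numbers object \<open>N\<close> of \<open>Cat(E)\<close> with
  \<open>disc N\<^sub>0\<close> yields a functor \<open>N \<rightarrow> disc N\<^sub>0\<close> that is the identity on objects; so the source and target
  maps of \<open>N\<close> agree, and their coequaliser is invertible.\<close>

section \<open>Record projections and uniqueness of arrows into a terminal object\<close>

lemma underlying_simps:
  "Ob (underlying K) = Ob K" "Ar (underlying K) = Ar K" "Dom (underlying K) = Dom K"
  "Cod (underlying K) = Cod K" "Ident (underlying K) = Ident K" "Comp (underlying K) = Comp K"
  "hom (underlying K) X Y = hom K X Y"
  by (simp_all add: underlying_def cat.truncate_def hom_def)

lemma terminal_unique:
  "terminal C T \<Longrightarrow> X \<in> Ob C \<Longrightarrow> f \<in> hom C X T \<Longrightarrow> g \<in> hom C X T \<Longrightarrow> f = g"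
  unfolding terminal_def by blast

lemma disc_icat_simps [simp]:
  "ob0 (disc_icat C X) = X" "ob1 (disc_icat C X) = X" "isrc (disc_icat C X) = Ident C X"
  "itgt (disc_icat C X) = Ident C X" "iid (disc_icat C X) = Ident C X"
  "icmp (disc_icat C X) = pb1 C (Ident C X) (Ident C X)"
  by (simp_all add: disc_icat_def)

context finitely_complete_category
begin

section \<open>Functors out of discrete categories\<close>

text \<open>Every arrow of a discrete category is an identity, so it must be sent to the identity on
  the image of its object; this dictates the arrow part.\<close>

definition disc_lift :: "'o \<Rightarrow> ('o, 'a) icat \<Rightarrow> 'a \<Rightarrow> ('o, 'a) ifun" where
  "disc_lift X A x = \<lparr>fdom = disc_icat E X, fcod = A, fob = x, far = iid A \<cdot> x\<rparr>"

lemma disc_lift_simps [simp]: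
  "fdom (disc_lift X A x) = disc_icat E X" "fcod (disc_lift X A x) = A" "fob (disc_lift X A x) = x"
  "far (disc_lift X A x) = iid A \<cdot> x"
  by (simp_all add: disc_lift_def)

lemma is_ifun_disc_lift:
  assumes A: "is_icat E A" and x: "x \<in> hom E X (ob0 A)"
  shows "is_ifun E (disc_lift X A x)"
proof -
  have X: "X \<in> Ob E" using homD[OF x] by simp
  note a = icatD[OF A] and i = Ident_hom[OF X]
  note p = pb_projs[OF i i]
  have e: "pb2 E (Ident E X) (Ident E X) = pb1 E (Ident E X) (Ident E X)"
    using p Ident_Comp[OF p(1)] Ident_Comp[OF p(2)] by simp
  note ix = Comp_hom[OF a(5) x]
  have s: "isrc A \<cdot> (iid A \<cdot> x) = x" "itgt A \<cdot> (iid A \<cdot> x) = x"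
    using ident_comp[OF a(7,3,5) x] ident_comp[OF a(8,4,5) x] by simp_all
  let ?p = "pb1 E (Ident E X) (Ident E X)"
  \<comment> \<open>Preservation of composition: as the two projections agree by \<open>e\<close>,
    only an identity arrow composed with itself remains, which is an instance of the left unit
    law.\<close>
  have "icomp E A ((iid A \<cdot> x) \<cdot> ?p) ((iid A \<cdot> x) \<cdot> ?p) = (iid A \<cdot> x) \<cdot> ?p"
    using icomp_unit(1)[OF A Comp_hom[OF ix p(1)]] s Comp_assoc[OF a(3) ix p(1)] Comp_assoc[OF a(5) x p(1)]
    by simp
  then show ?thesis
    using is_icat_disc[OF X] A x ix s e Comp_Ident[OF x] Comp_Ident[OF ix] by (simp add: is_ifun_def)
qed

text \<open>The identity map of a discrete category is itself an identity arrow of \<open>E\<close>,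
  so preservation of identities determines \<open>far F\<close> from \<open>fob F\<close>.\<close>

lemma ifun_from_disc:
  assumes F: "is_ifun E F" and d: "fdom F = disc_icat E X"
  shows "F = disc_lift X (fcod F) (fob F)" "fob F \<in> hom E X (ob0 (fcod F))"
  using ifunD[OF F] d Comp_Ident[of "far F" X] by (auto simp: disc_lift_def)

text \<open>Naturality is automatic: the arrow parts of both functors take identities as values, so
  both sides of the naturality square reduce to \<open>c\<close> by the unit laws.\<close>

lemma inat_from_disc:
  assumes A: "is_icat E A" and c: "c \<in> hom E X (ob1 A)"
  shows "is_inat E \<lparr>nsrc = disc_lift X A (isrc A \<cdot> c), ntgt = disc_lift X A (itgt A \<cdot> c), ncomp = c\<rparr>"
  using is_ifun_disc_lift[OF A Comp_hom[OF icatD(3)[OF A] c]]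
    is_ifun_disc_lift[OF A Comp_hom[OF icatD(4)[OF A] c]]
    c Comp_Ident[OF c] icomp_unit[OF A c]
  by (simp add: is_inat_def)

lemma ifun_comp_disc_lift:
  assumes G: "is_ifun E G" and x: "x \<in> hom E X (ob0 (fdom G))"
  shows "ifun_comp E G (disc_lift X (fdom G) x) = disc_lift X (fcod G) (fob G \<cdot> x)"
  using ifun_id_at[OF G x] by (simp add: disc_lift_def ifun_comp_def)

lemma disc_lift_comp:
  assumes A: "is_icat E A" and x: "x \<in> hom E Y (ob0 A)" and f: "f \<in> hom E X Y"
  shows "ifun_comp E (disc_lift Y A x) (Far (disc E) f) = disc_lift X A (x \<cdot> f)"
  using Comp_assoc[OF icatD(5)[OF A] x f] homD[OF f] by (simp add: disc_lift_def ifun_comp_def disc_def)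

text \<open>Whiskering composes horizontally with an identity cell, so its component contains an
  identity arrow of the target category as a factor; the unit laws remove it.\<close>

lemma whiskers:
  assumes \<phi>: "is_inat E \<phi>"
  shows "is_ifun E F \<Longrightarrow> fcod F = fdom (nsrc \<phi>) \<Longrightarrow> whisker_right (Cat E) \<phi> F =
      \<lparr>nsrc = ifun_comp E (nsrc \<phi>) F, ntgt = ifun_comp E (ntgt \<phi>) F, ncomp = ncomp \<phi> \<cdot> fob F\<rparr>"
    and "is_ifun E G \<Longrightarrow> fdom G = fcod (nsrc \<phi>) \<Longrightarrow> whisker_left (Cat E) G \<phi> =
      \<lparr>nsrc = ifun_comp E G (nsrc \<phi>), ntgt = ifun_comp E G (ntgt \<phi>), ncomp = far G \<cdot> ncomp \<phi>\<rparr>"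
proof -
  note n = inatD[OF \<phi>]
  { assume F: "is_ifun E F" and d: "fcod F = fdom (nsrc \<phi>)"
    note f = ifunD[OF F, unfolded d] and h = inat_at[OF \<phi> ifunD(3)[OF F, unfolded d]]
    show "whisker_right (Cat E) \<phi> F =
        \<lparr>nsrc = ifun_comp E (nsrc \<phi>) F, ntgt = ifun_comp E (ntgt \<phi>) F, ncomp = ncomp \<phi> \<cdot> fob F\<rparr>"
      using icomp_unit(1)[OF ifunD(2)[OF n(1)] h(1)] h(2) ifun_id_at[OF n(1) f(3)] d
      by (simp add: whisker_right_def Cat_def) }
  { assume G: "is_ifun E G" and d: "fdom G = fcod (nsrc \<phi>)"
    note g = ifunD[OF G, unfolded d] and h = ifun_at[OF G, unfolded d, OF n(5)]
    have "fob (ntgt \<phi>) \<in> hom E (ob0 (fdom (nsrc \<phi>))) (ob0 (fcod (nsrc \<phi>)))"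
      using ifunD(3)[OF n(2)] n by simp
    then show "whisker_left (Cat E) G \<phi> =
        \<lparr>nsrc = ifun_comp E G (nsrc \<phi>), ntgt = ifun_comp E G (ntgt \<phi>), ncomp = far G \<cdot> ncomp \<phi>\<rparr>"
      using icomp_unit(2)[OF g(2) h(1)] h(3) n(7) Comp_assoc[OF icatD(5)[OF g(2)] g(3)]
      by (simp add: whisker_left_def Cat_def) }
qed

section \<open>Discrete terminal object and discrete natural numbers object\<close>

text \<open>The objects and the arrows of \<open>disc_icat E T\<close> both form \<open>T\<close>,
  so every equation required of a functor into it, and every comparison of components, is between
  parallel arrows into \<open>T\<close>.\<close>

lemma terminal2_disc:
  assumes T: "terminal E T"
  shows "terminal2 (Cat E) (disc_icat E T)"
proof -
  have T0: "T \<in> Ob E" using T by (simp add: terminal_def)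
  note D = is_icat_disc[OF T0]
  note i = Ident_hom[OF T0]
  have eq: "f = g" if "f \<in> hom E X T" "g \<in> hom E X T" for f g X
    using terminal_unique[OF T _ that] homD[OF that(1)] by simp
  have ex1: "\<exists>!F. is_ifun E F \<and> fdom F = A \<and> fcod F = disc_icat E T" if A: "is_icat E A" for A
  proof -
    note a = icatD[OF A] and q = pb_projs[OF icatD(4,3)[OF A]]
    obtain x y where x: "x \<in> hom E (ob0 A) T" and y: "y \<in> hom E (ob1 A) T"
      using T a(1,2) unfolding terminal_def by metis
    note h = Comp_hom[OF x a(3)] Comp_hom[OF x a(4)] Comp_hom[OF y a(5)] Comp_hom[OF y a(6)]
      Comp_hom[OF i x] Comp_hom[OF i y]
    \<comment> \<open>Uniqueness applies only to arrows known to lie in a common hom set, so the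
      right-hand side of the composition law is typed first.\<close>
    have c: "icomp E (disc_icat E T) (y \<cdot> ipair1 E A) (y \<cdot> ipair2 E A) \<in> hom E (ipairs E A) T"
      using icomp(1)[OF D, of "y \<cdot> ipair1 E A" "ipairs E A" "y \<cdot> ipair2 E A"] Comp_hom[OF y q(1)]
        Comp_hom[OF y q(2)] eq[OF Comp_hom[OF y q(1)] Comp_hom[OF y q(2)]] by simp
    show ?thesis
    proof (rule ex1I)
      show "is_ifun E \<lparr>fdom = A, fcod = disc_icat E T, fob = x, far = y\<rparr> \<and>
          fdom \<lparr>fdom = A, fcod = disc_icat E T, fob = x, far = y\<rparr> = A \<and>
          fcod \<lparr>fdom = A, fcod = disc_icat E T, fob = x, far = y\<rparr> = disc_icat E T"
        using A D x y eq[OF h(6,1)] eq[OF h(6,2)] eq[OF h(3,5)] eq[OF h(4) c]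
        by (simp add: is_ifun_def)
      fix F assume F: "is_ifun E F \<and> fdom F = A \<and> fcod F = disc_icat E T"
      then have "fob F = x" "far F = y" using ifunD(3,4)[of F] eq x y by auto
      then show "F = \<lparr>fdom = A, fcod = disc_icat E T, fob = x, far = y\<rparr>" using F by simp
    qed
  qed
  have ex2: "\<exists>!\<alpha>. is_inat E \<alpha> \<and> nsrc \<alpha> = F \<and> ntgt \<alpha> = G"
    if F: "is_ifun E F" and G: "is_ifun E G" and d: "fdom G = fdom F" "fcod F = disc_icat E T"
      "fcod G = disc_icat E T" for F G
  proof -
    note f = ifunD[OF F, unfolded d]
    \<comment> \<open>Parallel functors into the terminal category coincide, so the identity cell is
      available as a witness.\<close>
    have FG: "F = G" using ex1[OF f(1)] F G d by blast
    show ?thesis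
    proof (rule ex1I)
      show "is_inat E (VIdent (Cat E) F) \<and> nsrc (VIdent (Cat E) F) = F \<and> ntgt (VIdent (Cat E) F) = G"
        using inat_VIdent[OF F] FG by (simp add: Cat_def)
      fix \<alpha> assume \<alpha>: "is_inat E \<alpha> \<and> nsrc \<alpha> = F \<and> ntgt \<alpha> = G"
      then have "ncomp \<alpha> \<in> hom E (ob0 (fdom F)) T" using inatD(5)[of \<alpha>] d by simp
      moreover have "Ident E T \<cdot> fob F \<in> hom E (ob0 (fdom F)) T" using Comp_hom[OF i] f(3) by simp
      ultimately have "ncomp \<alpha> = Ident E T \<cdot> fob F" using eq by blast
      then show "\<alpha> = VIdent (Cat E) F" using \<alpha> FG d(3) by (auto simp: Cat_def intro: inat.equality)
    qed
  qed
  show ?thesis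
    unfolding terminal2_def terminal_def underlying_simps Cat_simps mem_Collect_eq
    using D ex1 ex2 by (intro conjI ballI) (simp_all add: Cat_simps)
qed

lemma nno2_disc:
  assumes N: "nno E T N z s"
  shows "nno2 (Cat E) (disc_icat E T) (disc_icat E N) (Far (disc E) z) (Far (disc E) s)"
proof -
  have T: "terminal E T" and z: "z \<in> hom E T N" and s: "s \<in> hom E N N"
    using N by (simp_all add: nno_def)
  have rec: "\<exists>!u. u \<in> hom E N X \<and> u \<cdot> z = f \<and> u \<cdot> s = g \<cdot> u"
    if "f \<in> hom E T X" "g \<in> hom E X X" for f g X
    using N that homD[OF that(1)] by (simp add: nno_def)
  note dz = homD[OF z] and ds = homD[OF s]
  have fz: "is_ifun E (Far (disc E) z)" "fdom (Far (disc E) z) = disc_icat E T"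
      "fcod (Far (disc E) z) = disc_icat E N" "fob (Far (disc E) z) = z"
    and fs: "is_ifun E (Far (disc E) s)" "fdom (Far (disc E) s) = disc_icat E N"
      "fcod (Far (disc E) s) = disc_icat E N" "fob (Far (disc E) s) = s"
    using is_functor_disc dz ds
    by (auto simp: is_functor_def underlying_simps Cat_simps) (simp_all add: disc_def)
  \<comment> \<open>Both sides of each functor equation are lifts from a discrete category, so the
    recursion equations can be read off on objects.\<close>
  have sq: "ifun_comp E (disc_lift N A x) (Far (disc E) z) = disc_lift T A f \<longleftrightarrow> x \<cdot> z = f"
    "ifun_comp E (disc_lift N A x) (Far (disc E) s) = ifun_comp E G (disc_lift N A x) \<longleftrightarrow> x \<cdot> s = fob G \<cdot> x"
    if "is_ifun E G" "fdom G = A" "fcod G = A" "x \<in> hom E N (ob0 A)" for A G x f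
    using disc_lift_comp[OF _ that(4) z] disc_lift_comp[OF _ that(4) s]
      ifun_comp_disc_lift[OF that(1), of x N] that ifunD[OF that(1)]
    by (auto simp: disc_lift_def)
  have nno: "\<exists>!U. is_ifun E U \<and> fdom U = disc_icat E N \<and> fcod U = A \<and>
      ifun_comp E U (Far (disc E) z) = F \<and> ifun_comp E U (Far (disc E) s) = ifun_comp E G U"
    if F: "is_ifun E F" "fdom F = disc_icat E T" "fcod F = A"
      and G: "is_ifun E G" "fdom G = A" "fcod G = A" for A F G
  proof -
    have A: "is_icat E A" using ifunD[OF G(1)] G by simp
    have f: "fob F \<in> hom E T (ob0 A)" and F': "F = disc_lift T A (fob F)"
      using ifun_from_disc[OF F(1,2)] F(3) by simp_all
    have g: "fob G \<in> hom E (ob0 A) (ob0 A)" using ifunD[OF G(1)] G by simp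
    from rec[OF f g] obtain x where x: "x \<in> hom E N (ob0 A)" "x \<cdot> z = fob F" "x \<cdot> s = fob G \<cdot> x"
      and u: "\<And>y. y \<in> hom E N (ob0 A) \<Longrightarrow> y \<cdot> z = fob F \<Longrightarrow> y \<cdot> s = fob G \<cdot> y \<Longrightarrow> y = x"
      by blast
    show ?thesis
    proof (rule ex1I[of _ "disc_lift N A x"], intro conjI)
      show "is_ifun E (disc_lift N A x)" by (rule is_ifun_disc_lift[OF A x(1)])
      show "ifun_comp E (disc_lift N A x) (Far (disc E) z) = F"
        using sq(1)[OF G x(1), of "fob F"] x(2) F' by simp
      show "ifun_comp E (disc_lift N A x) (Far (disc E) s) = ifun_comp E G (disc_lift N A x)"
        using sq(2)[OF G x(1)] x(3) by simp
    next
      fix U assume U: "is_ifun E U \<and> fdom U = disc_icat E N \<and> fcod U = A \<and>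
        ifun_comp E U (Far (disc E) z) = F \<and> ifun_comp E U (Far (disc E) s) = ifun_comp E G U"
      then have y: "fob U \<in> hom E N (ob0 A)" and U': "U = disc_lift N A (fob U)"
        using ifun_from_disc[of U N] by auto
      have "fob U = x"
        using u[OF y] sq(1)[OF G y, of "fob F"] sq(2)[OF G y] U F' U' by metis
      then show "U = disc_lift N A x" using U' by simp
    qed (simp_all)
  qed
  have nno2: "\<exists>!\<phi>. (is_inat E \<phi> \<and> nsrc \<phi> = U \<and> ntgt \<phi> = U') \<and>
      whisker_right (Cat E) \<phi> (Far (disc E) z) = \<alpha> \<and>
      whisker_right (Cat E) \<phi> (Far (disc E) s) = whisker_left (Cat E) G \<phi>"
    if G: "is_ifun E G" "fdom G = A" "fcod G = A"
      and U: "is_ifun E U" "fdom U = disc_icat E N" "fcod U = A"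
      and U': "is_ifun E U'" "fdom U' = disc_icat E N" "fcod U' = A"
      and F: "ifun_comp E U (Far (disc E) z) = F" "ifun_comp E U (Far (disc E) s) = ifun_comp E G U"
      and F': "ifun_comp E U' (Far (disc E) z) = F'" "ifun_comp E U' (Far (disc E) s) = ifun_comp E G U'"
      and \<alpha>: "is_inat E \<alpha>" "nsrc \<alpha> = F" "ntgt \<alpha> = F'" for A G U U' F F' \<alpha>
  proof -
    have A: "is_icat E A" using ifunD[OF G(1)] G by simp
    note a = icatD[OF A] and g = ifunD[OF G(1), unfolded G]
    have u: "fob U \<in> hom E N (ob0 A)" and Ud: "disc_lift N A (fob U) = U"
      using ifun_from_disc[OF U(1,2)] U(3) by simp_all
    have u': "fob U' \<in> hom E N (ob0 A)" and Ud': "disc_lift N A (fob U') = U'"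
      using ifun_from_disc[OF U'(1,2)] U'(3) by simp_all
    have uz: "fob U \<cdot> z = fob F" "fob U \<cdot> s = fob G \<cdot> fob U"
      using F fz(4) fs(4) by (auto simp: ifun_comp_def dest: arg_cong[where f = fob])
    have uz': "fob U' \<cdot> z = fob F'" "fob U' \<cdot> s = fob G \<cdot> fob U'"
      using F' fz(4) fs(4) by (auto simp: ifun_comp_def dest: arg_cong[where f = fob])
    have Fd: "fdom F = disc_icat E T" "fcod F = A" using F(1) fz U by (auto simp: ifun_comp_def)
    have c: "ncomp \<alpha> \<in> hom E T (ob1 A)" "isrc A \<cdot> ncomp \<alpha> = fob F" "itgt A \<cdot> ncomp \<alpha> = fob F'"
      using inatD[OF \<alpha>(1)] \<alpha> Fd by simp_all
    \<comment> \<open>The component of the required cell is defined by recursion in the object of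
      arrows: it starts at the component of \<open>\<alpha>\<close> and steps by
      \<open>far G\<close>.\<close>
    from rec[OF c(1) g(4)] obtain x where
      x: "x \<in> hom E N (ob1 A)" "x \<cdot> z = ncomp \<alpha>" "x \<cdot> s = far G \<cdot> x"
      and xu: "\<And>y. y \<in> hom E N (ob1 A) \<Longrightarrow> y \<cdot> z = ncomp \<alpha> \<Longrightarrow> y \<cdot> s = far G \<cdot> y \<Longrightarrow> y = x"
      by blast
    \<comment> \<open>Since \<open>isrc A\<close> intertwines \<open>far G\<close> with
      \<open>fob G\<close>, both \<open>isrc A \<cdot> x\<close> and \<open>fob U\<close> solve the
      same recursion in \<open>ob0 A\<close>. The target is treated in the same way with
      \<open>U'\<close>.\<close>
    have "isrc A \<cdot> x = fob U"
    proof -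
      have "(isrc A \<cdot> x) \<cdot> z = fob F" using Comp_assoc[OF a(3) x(1) z] x c by simp
      moreover have "(isrc A \<cdot> x) \<cdot> s = fob G \<cdot> (isrc A \<cdot> x)"
        using Comp_assoc[OF a(3) x(1) s] x square_comp[OF g(5) a(3) g(4,3) a(3) x(1)] by simp
      moreover have "fob F \<in> hom E T (ob0 A)" using Comp_hom[OF u z] uz by simp
      ultimately show ?thesis using rec[OF _ g(3)] Comp_hom[OF a(3) x(1)] u uz by blast
    qed
    moreover have "itgt A \<cdot> x = fob U'"
    proof -
      have "(itgt A \<cdot> x) \<cdot> z = fob F'" using Comp_assoc[OF a(4) x(1) z] x c by simp
      moreover have "(itgt A \<cdot> x) \<cdot> s = fob G \<cdot> (itgt A \<cdot> x)"
        using Comp_assoc[OF a(4) x(1) s] x square_comp[OF g(6) a(4) g(4,3) a(4) x(1)] by simp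
      moreover have "fob F' \<in> hom E T (ob0 A)" using Comp_hom[OF u' z] uz' by simp
      ultimately show ?thesis using rec[OF _ g(3)] Comp_hom[OF a(4) x(1)] u' uz' by blast
    qed
    ultimately have nat: "is_inat E \<lparr>nsrc = U, ntgt = U', ncomp = x\<rparr>"
      using inat_from_disc[OF A x(1)] Ud Ud' by simp
    \<comment> \<open>The 1-cells bounding the whiskered cells already agree by the recursion
      equations for \<open>U\<close> and \<open>U'\<close>, so only components have to be
      compared.\<close>
    have wz: "whisker_right (Cat E) \<phi> (Far (disc E) z) = \<alpha> \<longleftrightarrow> ncomp \<phi> \<cdot> z = ncomp \<alpha>"
      and ws: "whisker_right (Cat E) \<phi> (Far (disc E) s) = whisker_left (Cat E) G \<phi> \<longleftrightarrow>
        ncomp \<phi> \<cdot> s = far G \<cdot> ncomp \<phi>"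
      if "is_inat E \<phi>" "nsrc \<phi> = U" "ntgt \<phi> = U'" for \<phi>
      using whiskers(1)[OF that(1) fz(1)] whiskers(1)[OF that(1) fs(1)] whiskers(2)[OF that(1) G(1)]
        that F F' \<alpha> fz fs U G by (auto intro: inat.equality)
    show ?thesis
    proof (rule ex1I[of _ "\<lparr>nsrc = U, ntgt = U', ncomp = x\<rparr>"], intro conjI)
      show "whisker_right (Cat E) \<lparr>nsrc = U, ntgt = U', ncomp = x\<rparr> (Far (disc E) z) = \<alpha>"
        using wz[OF nat] x by simp
      show "whisker_right (Cat E) \<lparr>nsrc = U, ntgt = U', ncomp = x\<rparr> (Far (disc E) s) =
          whisker_left (Cat E) G \<lparr>nsrc = U, ntgt = U', ncomp = x\<rparr>"
        using ws[OF nat] x by simp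
    next
      fix \<phi> assume \<phi>: "(is_inat E \<phi> \<and> nsrc \<phi> = U \<and> ntgt \<phi> = U') \<and>
        whisker_right (Cat E) \<phi> (Far (disc E) z) = \<alpha> \<and>
        whisker_right (Cat E) \<phi> (Far (disc E) s) = whisker_left (Cat E) G \<phi>"
      then have "ncomp \<phi> = x" using xu[of "ncomp \<phi>"] wz[of \<phi>] ws[of \<phi>] inatD(5)[of \<phi>] U by simp
      then show "\<phi> = \<lparr>nsrc = U, ntgt = U', ncomp = x\<rparr>" using \<phi> by simp
    qed (simp_all add: nat)
  qed
  have t2: "terminal2 (Cat E) (disc_icat E T)" by (rule terminal2_disc[OF T])
  then have "nno (underlying (Cat E)) (disc_icat E T) (disc_icat E N) (Far (disc E) z) (Far (disc E) s)"
    using nno fz fs is_icat_disc[of N] ds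
    by (auto simp: nno_def terminal2_def underlying_simps Cat_simps conj_assoc)
  then show ?thesis
    unfolding nno2_def Cat_simps(1,5,10)
  proof (intro conjI ballI impI)
    fix A F F' G U U' \<alpha>
    assume h: "F \<in> hom (Cat E) (disc_icat E T) A" "F' \<in> hom (Cat E) (disc_icat E T) A"
      "G \<in> hom (Cat E) A A" "U \<in> hom (Cat E) (disc_icat E N) A" "U' \<in> hom (Cat E) (disc_icat E N) A"
      and e: "ifun_comp E U (Far (disc E) z) = F \<and> ifun_comp E U (Far (disc E) s) = ifun_comp E G U \<and>
        ifun_comp E U' (Far (disc E) z) = F' \<and> ifun_comp E U' (Far (disc E) s) = ifun_comp E G U'"
      and \<alpha>: "\<alpha> \<in> cells (Cat E) F F'"
    show "\<exists>!\<phi>. (is_inat E \<phi> \<and> nsrc \<phi> = U \<and> ntgt \<phi> = U') \<and>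
        whisker_right (Cat E) \<phi> (Far (disc E) z) = \<alpha> \<and>
        whisker_right (Cat E) \<phi> (Far (disc E) s) = whisker_left (Cat E) G \<phi>"
      by (rule nno2) (use h e \<alpha> in \<open>simp_all add: Cat_simps\<close>)
  qed (use t2 in simp_all)
qed

section \<open>Functors into codiscrete categories\<close>

text \<open>In an internal preorder the unit and associativity laws, and the functoriality of maps into
  it, hold automatically.\<close>

definition jointly_monic :: "('o, 'a) icat \<Rightarrow> bool" where
  "jointly_monic A \<longleftrightarrow> (\<forall>W. \<forall>u \<in> hom E W (ob1 A). \<forall>v \<in> hom E W (ob1 A).
     isrc A \<cdot> u = isrc A \<cdot> v \<and> itgt A \<cdot> u = itgt A \<cdot> v \<longrightarrow> u = v)"

lemma jointly_monicD:
  "jointly_monic A \<Longrightarrow> u \<in> hom E W (ob1 A) \<Longrightarrow> v \<in> hom E W (ob1 A) \<Longrightarrow>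
   isrc A \<cdot> u = isrc A \<cdot> v \<Longrightarrow> itgt A \<cdot> u = itgt A \<cdot> v \<Longrightarrow> u = v"
  unfolding jointly_monic_def by blast

lemma is_icat_preorder:
  assumes m: "jointly_monic A"
    and a: "isrc A \<in> hom E (ob1 A) (ob0 A)" "itgt A \<in> hom E (ob1 A) (ob0 A)"
      "iid A \<in> hom E (ob0 A) (ob1 A)" "icmp A \<in> hom E (ipairs E A) (ob1 A)"
      "isrc A \<cdot> iid A = Ident E (ob0 A)" "itgt A \<cdot> iid A = Ident E (ob0 A)"
      "isrc A \<cdot> icmp A = isrc A \<cdot> ipair1 E A" "itgt A \<cdot> icmp A = itgt A \<cdot> ipair2 E A"
  shows "is_icat E A"
proof -
  note p = pb_projs[OF a(2,1)] and o = homD[OF a(1)]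
  \<comment> \<open>The lemma \<open>icomp\<close> presupposes an internal category, so the typing
    and the endpoints of composites are derived here from the source and target laws of
    \<open>icmp\<close> alone.\<close>
  have c: "icomp E A x y \<in> hom E W (ob1 A)" "isrc A \<cdot> icomp E A x y = isrc A \<cdot> x"
    "itgt A \<cdot> icomp E A x y = itgt A \<cdot> y"
    if xy: "x \<in> hom E W (ob1 A)" "y \<in> hom E W (ob1 A)" "itgt A \<cdot> x = isrc A \<cdot> y" for W x y
  proof -
    note q = pb_pair[OF a(2,1) xy]
    show "icomp E A x y \<in> hom E W (ob1 A)" using Comp_hom[OF a(4) q(1)] by (simp add: icomp_def)
    show "isrc A \<cdot> icomp E A x y = isrc A \<cdot> x" unfolding icomp_def
      using square_comp[OF a(7,1,4,1) p(1) q(1)] q by simp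
    show "itgt A \<cdot> icomp E A x y = itgt A \<cdot> y" unfolding icomp_def
      using square_comp[OF a(8,2,4,2) p(2) q(1)] q by simp
  qed
  have i: "Ident E (ob1 A) \<in> hom E (ob1 A) (ob1 A)" using Ident_hom o by simp
  note si = Comp_Ident[OF a(1)] and ti = Comp_Ident[OF a(2)]
  note hs = Comp_hom[OF a(3,1)] and ht = Comp_hom[OF a(3,2)]
  have s: "isrc A \<cdot> (iid A \<cdot> isrc A) = isrc A" "itgt A \<cdot> (iid A \<cdot> isrc A) = isrc A"
      "isrc A \<cdot> (iid A \<cdot> itgt A) = itgt A" "itgt A \<cdot> (iid A \<cdot> itgt A) = itgt A"
    using ident_comp[OF a(5,1,3,1)] ident_comp[OF a(6,2,3,1)]
      ident_comp[OF a(5,1,3,2)] ident_comp[OF a(6,2,3,2)] by simp_all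
  \<comment> \<open>Each remaining law compares two arrows into \<open>ob1 A\<close>, so it suffices
    to compute their sources and targets.\<close>
  have 1: "icomp E A (iid A \<cdot> isrc A) (Ident E (ob1 A)) = Ident E (ob1 A)"
    by (rule jointly_monicD[OF m c(1)[OF hs i] i]) (use c[OF hs i] s si ti in simp_all)
  have 2: "icomp E A (Ident E (ob1 A)) (iid A \<cdot> itgt A) = Ident E (ob1 A)"
    by (rule jointly_monicD[OF m c(1)[OF i ht] i]) (use c[OF i ht] s si ti in simp_all)
  let ?r1 = "pb1 E (ipair2 E A) (ipair1 E A)" and ?r2 = "pb2 E (ipair2 E A) (ipair1 E A)"
  note r = pb_projs[OF p(2,1)]
  note h = Comp_hom[OF a(4) r(1)] Comp_hom[OF p(2) r(2)] Comp_hom[OF p(1) r(1)] Comp_hom[OF a(4) r(2)]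
  note s1 = square_comp[OF a(7,1,4,1) p(1) r(1)] and t1 = square_comp[OF a(8,2,4,2) p(2) r(1)]
    and s2 = square_comp[OF a(7,1,4,1) p(1) r(2)] and t2 = square_comp[OF a(8,2,4,2) p(2) r(2)]
  have e1: "itgt A \<cdot> (icmp A \<cdot> ?r1) = isrc A \<cdot> (ipair2 E A \<cdot> ?r2)"
    using t1 square_comp[OF p(3) a(2) p(1) a(1) p(2) r(2)] r(3) by simp
  have e2: "itgt A \<cdot> (ipair1 E A \<cdot> ?r1) = isrc A \<cdot> (icmp A \<cdot> ?r2)"
    using s2 square_comp[OF p(3) a(2) p(1) a(1) p(2) r(1)] r(3) by simp
  have 3: "icomp E A (icmp A \<cdot> ?r1) (ipair2 E A \<cdot> ?r2) = icomp E A (ipair1 E A \<cdot> ?r1) (icmp A \<cdot> ?r2)"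
    by (rule jointly_monicD[OF m c(1)[OF h(1,2) e1] c(1)[OF h(3,4) e2]])
      (use c[OF h(1,2) e1] c[OF h(3,4) e2] s1 t2 in simp_all)
  show ?thesis using o a 1 2 3 by (simp add: is_icat_def Let_def)
qed

text \<open>Preservation of identities and of composition are equations between arrows into
  \<open>ob1 (fcod F)\<close>; compatibility with source and target gives both sides the same
  endpoints.\<close>

lemma is_ifun_preorder:
  assumes m: "jointly_monic (fcod F)" and A: "is_icat E (fdom F)" and B: "is_icat E (fcod F)"
    and f: "fob F \<in> hom E (ob0 (fdom F)) (ob0 (fcod F))" "far F \<in> hom E (ob1 (fdom F)) (ob1 (fcod F))"
      "isrc (fcod F) \<cdot> far F = fob F \<cdot> isrc (fdom F)" "itgt (fcod F) \<cdot> far F = fob F \<cdot> itgt (fdom F)"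
  shows "is_ifun E F"
proof -
  let ?A = "fdom F" and ?B = "fcod F"
  note a = icatD[OF A] and b = icatD[OF B]
  note p = pb_projs[OF a(4,3)]
  have s: "isrc ?B \<cdot> (far F \<cdot> x) = fob F \<cdot> (isrc ?A \<cdot> x)"
    and t: "itgt ?B \<cdot> (far F \<cdot> x) = fob F \<cdot> (itgt ?A \<cdot> x)"
    if "x \<in> hom E W (ob1 ?A)" for x W
    using square_comp[OF f(3) b(3) f(2,1) a(3) that] square_comp[OF f(4) b(4) f(2,1) a(4) that] by simp_all
  have 1: "far F \<cdot> iid ?A = iid ?B \<cdot> fob F"
    by (rule jointly_monicD[OF m Comp_hom[OF f(2) a(5)] Comp_hom[OF b(5) f(1)]])
      (use s[OF a(5)] t[OF a(5)] a(7,8) Comp_Ident[OF f(1)] ident_comp[OF b(7,3,5) f(1)]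
        ident_comp[OF b(8,4,5) f(1)] in simp_all)
  have e: "itgt ?B \<cdot> (far F \<cdot> ipair1 E ?A) = isrc ?B \<cdot> (far F \<cdot> ipair2 E ?A)"
    using s[OF p(2)] t[OF p(1)] p(3) by simp
  note c = icomp[OF B Comp_hom[OF f(2) p(1)] Comp_hom[OF f(2) p(2)] e]
  have 2: "far F \<cdot> icmp ?A = icomp E ?B (far F \<cdot> ipair1 E ?A) (far F \<cdot> ipair2 E ?A)"
    by (rule jointly_monicD[OF m Comp_hom[OF f(2) a(6)] c(1)])
      (use c s[OF a(6)] t[OF a(6)] s[OF p(1)] t[OF p(2)] a(9,10) in simp_all)
  show ?thesis using A B f 1 2 by (simp add: is_ifun_def)
qed

text \<open>The object part fixes the source and target of \<open>far\<close>, and these determine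
  \<open>far\<close> when the codomain is a preorder.\<close>

lemma ifun_preorder_eqI:
  assumes F: "is_ifun E F" and G: "is_ifun E G" and d: "fdom F = fdom G" "fcod F = fcod G"
    and m: "jointly_monic (fcod G)" and e: "fob F = fob G"
  shows "F = G"
proof -
  note f = ifunD[OF F, unfolded d] and g = ifunD[OF G]
  have "far F = far G" by (rule jointly_monicD[OF m f(4) g(4)]) (use f g e in simp_all)
  then show ?thesis using d e by simp
qed

text \<open>The witness has exactly one arrow between any two generalised objects: its object of
  arrows is the product of \<open>X\<close> with itself, formed as a pullback over \<open>T\<close>.
  Together with \<open>ifun_preorder_eqI\<close> this is the adjunction with the objects functor on
  the left and the codiscrete category on the right.\<close>

lemma codiscrete_exists:
  assumes T: "terminal E T" and X: "X \<in> Ob E"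
  shows "\<exists>B. is_icat E B \<and> ob0 B = X \<and> jointly_monic B \<and>
    (\<forall>A x. is_icat E A \<and> x \<in> hom E (ob0 A) X \<longrightarrow>
       (\<exists>F. is_ifun E F \<and> fdom F = A \<and> fcod F = B \<and> fob F = x))"
proof -
  obtain t where t: "t \<in> hom E X T" using T X unfolding terminal_def by blast
  have eq: "t \<cdot> x = t \<cdot> y" if "x \<in> hom E W X" "y \<in> hom E W X" for x y W
    using terminal_unique[OF T _ Comp_hom[OF t that(1)] Comp_hom[OF t that(2)]] homD[OF that(1)] by simp
  note p = pb_projs[OF t t]
  have pair: "pb_pair E t t x y \<in> hom E W (pb E t t)" "pb1 E t t \<cdot> pb_pair E t t x y = x"
    "pb2 E t t \<cdot> pb_pair E t t x y = y" if "x \<in> hom E W X" "y \<in> hom E W X" for x y W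
    using pb_pair[OF t t that eq[OF that]] by simp_all
  note i = Ident_hom[OF X]
  note q = pb_projs[OF p(2,1)]
  \<comment> \<open>The identities form the diagonal. The composite keeps the source of the first
    arrow and the target of the second.\<close>
  define B where "B = \<lparr>ob0 = X, ob1 = pb E t t, isrc = pb1 E t t, itgt = pb2 E t t,
    iid = pb_pair E t t (Ident E X) (Ident E X),
    icmp = pb_pair E t t (pb1 E t t \<cdot> pb1 E (pb2 E t t) (pb1 E t t)) (pb2 E t t \<cdot> pb2 E (pb2 E t t) (pb1 E t t))\<rparr>"
  have B: "ob0 B = X" "ob1 B = pb E t t" "isrc B = pb1 E t t" "itgt B = pb2 E t t"
    by (simp_all add: B_def)
  have m: "jointly_monic B"
    unfolding jointly_monic_def B
  proof (intro allI ballI impI)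
    fix W u v assume "u \<in> hom E W (pb E t t)" "v \<in> hom E W (pb E t t)"
      "pb1 E t t \<cdot> u = pb1 E t t \<cdot> v \<and> pb2 E t t \<cdot> u = pb2 E t t \<cdot> v"
    then show "u = v" using pb_pair_eqI[OF t t, of u W] pb_pair_eqI[OF t t, of v W] by metis
  qed
  have ic: "is_icat E B"
    by (rule is_icat_preorder[OF m])
      (use p pair[OF i i] pair[OF Comp_hom[OF p(1) q(1)] Comp_hom[OF p(2) q(2)]] in \<open>simp_all add: B_def\<close>)
  have "\<exists>F. is_ifun E F \<and> fdom F = A \<and> fcod F = B \<and> fob F = x"
    if A: "is_icat E A" and x: "x \<in> hom E (ob0 A) X" for A x
  proof -
    note a = icatD[OF A]
    note h = pair[OF Comp_hom[OF x a(3)] Comp_hom[OF x a(4)]]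
    \<comment> \<open>An arrow is sent to the pair of the images of its source and target.\<close>
    let ?F = "\<lparr>fdom = A, fcod = B, fob = x, far = pb_pair E t t (x \<cdot> isrc A) (x \<cdot> itgt A)\<rparr>"
    have "is_ifun E ?F"
      by (rule is_ifun_preorder) (use m ic A x h in \<open>simp_all add: B\<close>)
    then show ?thesis by (intro exI[of _ ?F]) simp
  qed
  with m ic B(1) show ?thesis by blast
qed

section \<open>Terminal objects and natural numbers objects on the level of objects\<close>

text \<open>An arrow from \<open>X\<close> to \<open>ob0 T\<close> amounts to a functor from the
  discrete category on \<open>X\<close> to \<open>T\<close>, and there is exactly one of
  these.\<close>

lemma terminal_objs:
  assumes T: "terminal (underlying (Cat E)) T"
  shows "terminal E (ob0 T)"
proof -
  have ic: "is_icat E T" using T by (simp add: terminal_def underlying_simps Cat_simps)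
  have "\<exists>!f. f \<in> hom E X (ob0 T)" if X: "X \<in> Ob E" for X
  proof -
    have ex: "\<exists>!F. is_ifun E F \<and> fdom F = disc_icat E X \<and> fcod F = T"
      using T is_icat_disc[OF X] by (simp add: terminal_def underlying_simps Cat_simps)
    then obtain F where F: "is_ifun E F" "fdom F = disc_icat E X" "fcod F = T" by blast
    show ?thesis
    proof (rule ex1I)
      show "fob F \<in> hom E X (ob0 T)" using ifunD(3)[OF F(1)] F by simp
      fix f assume "f \<in> hom E X (ob0 T)"
      then have "is_ifun E (disc_lift X T f)" using is_ifun_disc_lift[OF ic] by blast
      then have "disc_lift X T f = F" using ex F by (metis disc_lift_simps(1,2))
      then show "f = fob F" by (metis disc_lift_simps(3))
    qed
  qed
  then show ?thesis using icatD(1)[OF ic] by (simp add: terminal_def)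
qed

text \<open>Recursion data on \<open>X\<close> lift to the codiscrete category on \<open>X\<close>;
  the recursive functor obtained there is then restricted to objects.\<close>

lemma nno_objs:
  assumes N: "nno (underlying (Cat E)) T N z s"
  shows "nno E (ob0 T) (ob0 N) (fob z) (fob s)"
proof -
  have T: "terminal (underlying (Cat E)) T" and icN: "is_icat E N"
    and z: "is_ifun E z" "fdom z = T" "fcod z = N" and s: "is_ifun E s" "fdom s = N" "fcod s = N"
    using N by (simp_all add: nno_def underlying_simps Cat_simps)
  have icT: "is_icat E T" using ifunD(1)[OF z(1)] z by simp
  have rec: "\<exists>!U. is_ifun E U \<and> fdom U = N \<and> fcod U = B \<and> ifun_comp E U z = F \<and> ifun_comp E U s = ifun_comp E G U"
    if "is_icat E B" "is_ifun E F" "fdom F = T" "fcod F = B" "is_ifun E G" "fdom G = B" "fcod G = B" for B F G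
    using N that by (simp add: nno_def underlying_simps Cat_simps conj_assoc)
  note T0 = terminal_objs[OF T]
  have "\<exists>!u. u \<in> hom E (ob0 N) X \<and> u \<cdot> fob z = f \<and> u \<cdot> fob s = g \<cdot> u"
    if X: "X \<in> Ob E" and f: "f \<in> hom E (ob0 T) X" and g: "g \<in> hom E X X" for X f g
  proof -
    from codiscrete_exists[OF T0 X] obtain B where B: "is_icat E B" "ob0 B = X" "jointly_monic B"
      and lift: "\<And>A x. is_icat E A \<Longrightarrow> x \<in> hom E (ob0 A) X \<Longrightarrow>
       \<exists>F. is_ifun E F \<and> fdom F = A \<and> fcod F = B \<and> fob F = x" by blast
    obtain F where F: "is_ifun E F" "fdom F = T" "fcod F = B" "fob F = f" using lift[OF icT f] by blast
    obtain G where G: "is_ifun E G" "fdom G = B" "fcod G = B" "fob G = g" using lift[OF B(1)] g B(2) by blast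
    have ex: "\<exists>!U. is_ifun E U \<and> fdom U = N \<and> fcod U = B \<and> ifun_comp E U z = F \<and> ifun_comp E U s = ifun_comp E G U"
      by (rule rec[OF B(1) F(1-3) G(1-3)])
    then obtain U where U: "is_ifun E U" "fdom U = N" "fcod U = B" "ifun_comp E U z = F"
      "ifun_comp E U s = ifun_comp E G U" by blast
    show ?thesis
    proof (rule ex1I, intro conjI)
      show "fob U \<in> hom E (ob0 N) X" using ifunD(3)[OF U(1)] U B by simp
      show "fob U \<cdot> fob z = f" using arg_cong[OF U(4), of fob] F by (simp add: ifun_comp_def)
      show "fob U \<cdot> fob s = g \<cdot> fob U" using arg_cong[OF U(5), of fob] G by (simp add: ifun_comp_def)
    next
      fix v assume v: "v \<in> hom E (ob0 N) X \<and> v \<cdot> fob z = f \<and> v \<cdot> fob s = g \<cdot> v"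
      then obtain V where V: "is_ifun E V" "fdom V = N" "fcod V = B" "fob V = v" using lift[OF icN] by blast
      \<comment> \<open>Functors into the preorder \<open>B\<close> are equal as soon as they agree
        on objects, so the equations for \<open>v\<close> lift to \<open>V\<close>.\<close>
      have "ifun_comp E V z = F"
        by (rule ifun_preorder_eqI)
          (use ifun_ifun_comp[OF z(1) V(1)] v V z F B in \<open>simp_all add: ifun_comp_def\<close>)
      moreover have "ifun_comp E V s = ifun_comp E G V"
        by (rule ifun_preorder_eqI)
          (use ifun_ifun_comp[OF s(1) V(1)] ifun_ifun_comp[OF V(1) G(1)] v V s G B in \<open>simp_all add: ifun_comp_def\<close>)
      ultimately have "V = U" using ex U V by blast
      then show "v = fob U" using V by simp
    qed
  qed
  then show ?thesis
    using T0 icatD(1)[OF icN] ifunD(3)[OF z(1)] ifunD(3)[OF s(1)] z s by (simp add: nno_def)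
qed

section \<open>Connected components\<close>

lemma nno_source_eq_target:
  assumes N: "nno (underlying (Cat E)) T N z s"
  shows "isrc N = itgt N"
proof -
  let ?D = "disc_icat E (ob0 N)" and ?T = "disc_icat E (ob0 T)"
  have icN: "is_icat E N" and z: "is_ifun E z" "fdom z = T" "fcod z = N"
    and s: "is_ifun E s" "fdom s = N" "fcod s = N"
    using N by (simp_all add: nno_def underlying_simps Cat_simps)
  note z0 = ifunD(3)[OF z(1), unfolded z] and s0 = ifunD(3)[OF s(1), unfolded s]
  note N0 = nno_objs[OF N] and icT = ifunD(1)[OF z(1), unfolded z]
  then have T0: "terminal E (ob0 T)" by (simp add: nno_def)
  have dz: "is_ifun E (Far (disc E) f)" "fdom (Far (disc E) f) = disc_icat E X"
      "fcod (Far (disc E) f) = disc_icat E Y" "fob (Far (disc E) f) = f" if "f \<in> hom E X Y" for f X Y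
    using is_functor_disc homD[OF that]
    by (auto simp: is_functor_def underlying_simps Cat_simps) (simp_all add: disc_def)
  \<comment> \<open>The given terminal object \<open>T\<close> need not literally be discrete.
    \<open>K\<close> compares it with the discrete one, so that the zero of \<open>ob0 N\<close>
    yields a functor out of \<open>T\<close>.\<close>
  obtain K where K: "is_ifun E K" "fdom K = T" "fcod K = ?T"
    using terminal2_disc[OF T0] icT by (auto simp: terminal2_def terminal_def underlying_simps Cat_simps)
  have K0: "fob K = Ident E (ob0 T)"
    using terminal_unique[OF T0] ifunD(3)[OF K(1)] Ident_hom[of "ob0 T"] icatD(1)[OF icT] K by simp
  let ?F = "ifun_comp E (Far (disc E) (fob z)) K"
  have F: "is_ifun E ?F" "fdom ?F = T" "fcod ?F = ?D" "fob ?F = fob z"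
    using ifun_ifun_comp[OF K(1) dz(1)[OF z0]] dz[OF z0] K K0 Comp_Ident[OF z0] by (simp_all add: ifun_comp_def)
  have "\<exists>!U. is_ifun E U \<and> fdom U = N \<and> fcod U = ?D \<and> ifun_comp E U z = ?F \<and>
      ifun_comp E U s = ifun_comp E (Far (disc E) (fob s)) U"
    using N is_icat_disc[OF icatD(1)[OF icN]] F dz[OF s0]
    by (simp add: nno_def underlying_simps Cat_simps conj_assoc)
  then obtain U where U: "is_ifun E U" "fdom U = N" "fcod U = ?D" "ifun_comp E U z = ?F"
      "ifun_comp E U s = ifun_comp E (Far (disc E) (fob s)) U" by blast
  note u = ifunD[OF U(1), unfolded U, simplified]
  \<comment> \<open>On objects, \<open>fob U\<close> and the identity solve the same recursion over
    the natural numbers object \<open>ob0 N\<close> of \<open>E\<close>.\<close>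
  have "fob U \<cdot> fob z = fob z" "fob U \<cdot> fob s = fob s \<cdot> fob U"
    using arg_cong[OF U(4), of fob] arg_cong[OF U(5), of fob] F dz[OF s0] by (simp_all add: ifun_comp_def)
  moreover have "\<exists>!v. v \<in> hom E (ob0 N) (ob0 N) \<and> v \<cdot> fob z = fob z \<and> v \<cdot> fob s = fob s \<cdot> v"
    using N0 icatD(1)[OF icN] z0 s0 by (simp add: nno_def)
  ultimately have "fob U = Ident E (ob0 N)"
    using u(3) Ident_hom[OF icatD(1)[OF icN]] Ident_Comp[OF z0] Ident_Comp[OF s0] Comp_Ident[OF s0] by metis
  \<comment> \<open>The source and target of \<open>?D\<close> are identities, so compatibility of
    \<open>U\<close> with them makes both \<open>isrc N\<close> and \<open>itgt N\<close> equal to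
    \<open>far U\<close>.\<close>
  then show ?thesis
    using u(5,6) Ident_Comp[OF icatD(3)[OF icN]] Ident_Comp[OF icatD(4)[OF icN]] by simp
qed

text \<open>Every arrow out of \<open>Cod E f\<close> coequalises the pair \<open>f\<close>,
  \<open>f\<close>. Factoring the identity through \<open>q\<close> gives a left inverse, and
  uniqueness of factorisations makes it two-sided.\<close>

lemma coequaliser_self_iso:
  assumes q: "is_coequaliser E f f q"
  shows "\<exists>r \<in> hom E (Cod E q) (Cod E f). r \<cdot> q = Ident E (Cod E f) \<and> q \<cdot> r = Ident E (Cod E q)"
proof -
  have f: "f \<in> hom E (Dom E f) (Cod E f)" and h: "q \<in> hom E (Cod E f) (Cod E q)"
    and u: "\<And>X x. x \<in> hom E (Cod E f) X \<Longrightarrow> \<exists>!u. u \<in> hom E (Cod E q) X \<and> u \<cdot> q = x"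
    using q by (auto simp: is_coequaliser_def)
  have o: "Cod E f \<in> Ob E" "Cod E q \<in> Ob E" using homD[OF h] by simp_all
  from u[OF Ident_hom[OF o(1)]] obtain r where r: "r \<in> hom E (Cod E q) (Cod E f)" "r \<cdot> q = Ident E (Cod E f)"
    by blast
  have "(q \<cdot> r) \<cdot> q = q" using Comp_assoc[OF h r(1) h] r(2) Comp_Ident[OF h] by simp
  then have "q \<cdot> r = Ident E (Cod E q)"
    using u[OF h] Comp_hom[OF h r(1)] Ident_hom[OF o(2)] Ident_Comp[OF h] by blast
  with r show ?thesis by blast
qed

text \<open>Needed because connected components reproduce the object of objects only up to
  isomorphism. The isomorphisms \<open>p\<close> and \<open>q\<close> must commute with zero and
  successor.\<close>

lemma nno_transport:
  assumes N: "nno E T N z s"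
    and p: "p \<in> hom E T T'" "p' \<in> hom E T' T" "p' \<cdot> p = Ident E T" "p \<cdot> p' = Ident E T'"
    and q: "q \<in> hom E N N'" "q' \<in> hom E N' N" "q' \<cdot> q = Ident E N" "q \<cdot> q' = Ident E N'"
    and z': "z' \<in> hom E T' N'" "z' \<cdot> p = q \<cdot> z" and s': "s' \<in> hom E N' N'" "s' \<cdot> q = q \<cdot> s"
  shows "nno E T' N' z' s'"
proof -
  have T: "terminal E T" and z: "z \<in> hom E T N" and s: "s \<in> hom E N N" using N by (simp_all add: nno_def)
  have cancel_p: "a = b" if "a \<in> hom E T' X" "b \<in> hom E T' X" "a \<cdot> p = b \<cdot> p" for a b X
    using Comp_assoc[OF that(1) p(1,2)] Comp_assoc[OF that(2) p(1,2)] that(3) p(4)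
      Comp_Ident[OF that(1)] Comp_Ident[OF that(2)] by metis
  have cancel_q: "a = b" if "a \<in> hom E N' X" "b \<in> hom E N' X" "a \<cdot> q = b \<cdot> q" for a b X
    using Comp_assoc[OF that(1) q(1,2)] Comp_assoc[OF that(2) q(1,2)] that(3) q(4)
      Comp_Ident[OF that(1)] Comp_Ident[OF that(2)] by metis
  have "\<exists>!f. f \<in> hom E X T'" if X: "X \<in> Ob E" for X
  proof -
    obtain x where x: "x \<in> hom E X T" using T X unfolding terminal_def by blast
    show ?thesis
    proof (rule ex1I)
      show "p \<cdot> x \<in> hom E X T'" by (rule Comp_hom[OF p(1) x])
      fix f assume f: "f \<in> hom E X T'"
      have "p' \<cdot> f = x" by (rule terminal_unique[OF T X Comp_hom[OF p(2) f] x])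
      then show "f = p \<cdot> x" using ident_comp[OF p(4,1,2) f] by simp
    qed
  qed
  then have T': "terminal E T'" using homD[OF p(1)] by (simp add: terminal_def)
  have "\<exists>!u. u \<in> hom E N' X \<and> u \<cdot> z' = f \<and> u \<cdot> s' = g \<cdot> u"
    if X: "X \<in> Ob E" and f: "f \<in> hom E T' X" and g: "g \<in> hom E X X" for X f g
  proof -
    \<comment> \<open>Precomposition with \<open>q\<close> turns recursion over \<open>N'\<close>
      into recursion over \<open>N\<close>; cancelling the isomorphisms \<open>p\<close> and
      \<open>q\<close> on the right gives the way back.\<close>
    have key: "(u \<cdot> z' = f \<and> u \<cdot> s' = g \<cdot> u) \<longleftrightarrow> ((u \<cdot> q) \<cdot> z = f \<cdot> p \<and> (u \<cdot> q) \<cdot> s = g \<cdot> (u \<cdot> q))"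
      if u: "u \<in> hom E N' X" for u
    proof -
      have "(u \<cdot> z') \<cdot> p = (u \<cdot> q) \<cdot> z"
        using Comp_assoc[OF u z'(1) p(1)] Comp_assoc[OF u q(1) z] z'(2) by simp
      moreover have "(u \<cdot> s') \<cdot> q = (u \<cdot> q) \<cdot> s"
        using Comp_assoc[OF u s'(1) q(1)] Comp_assoc[OF u q(1) s] s'(2) by simp
      moreover have "(g \<cdot> u) \<cdot> q = g \<cdot> (u \<cdot> q)" by (rule Comp_assoc[OF g u q(1)])
      ultimately show ?thesis
        using cancel_p[OF Comp_hom[OF u z'(1)] f] cancel_q[OF Comp_hom[OF u s'(1)] Comp_hom[OF g u]] by metis
    qed
    have ex: "\<exists>!v. v \<in> hom E N X \<and> v \<cdot> z = f \<cdot> p \<and> v \<cdot> s = g \<cdot> v"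
      using N X g Comp_hom[OF f p(1)] by (simp add: nno_def)
    then obtain v where v: "v \<in> hom E N X" "v \<cdot> z = f \<cdot> p" "v \<cdot> s = g \<cdot> v" by blast
    have vq: "(v \<cdot> q') \<cdot> q = v" using Comp_assoc[OF v(1) q(2,1)] q(3) Comp_Ident[OF v(1)] by simp
    note h = Comp_hom[OF v(1) q(2)]
    show ?thesis
    proof (rule ex1I[of _ "v \<cdot> q'"])
      show "v \<cdot> q' \<in> hom E N' X \<and> (v \<cdot> q') \<cdot> z' = f \<and> (v \<cdot> q') \<cdot> s' = g \<cdot> (v \<cdot> q')"
        using h key[OF h] v vq by simp
      fix u assume u: "u \<in> hom E N' X \<and> u \<cdot> z' = f \<and> u \<cdot> s' = g \<cdot> u"
      then have "u \<cdot> q \<in> hom E N X" "(u \<cdot> q) \<cdot> z = f \<cdot> p" "(u \<cdot> q) \<cdot> s = g \<cdot> (u \<cdot> q)"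
        using key[of u] Comp_hom[OF _ q(1)] by simp_all
      then have "u \<cdot> q = v" using ex v by blast
      then show "u = v \<cdot> q'" using cancel_q[OF _ h] u vq by simp
    qed
  qed
  then show ?thesis using T' z' s' homD[OF q(1)] by (simp add: nno_def)
qed

text \<open>Source and target have \<open>iid A\<close> as a common section, so they form a
  reflexive pair and the choice made by \<open>coeq\<close> is a genuine coequaliser.\<close>

lemma coeq_source_target:
  assumes R: "has_reflexive_coequalisers E" and A: "is_icat E A"
  shows "is_coequaliser E (isrc A) (itgt A) (coeq E (isrc A) (itgt A))"
proof -
  note a = icatD[OF A]
  have "reflexive_pair E (isrc A) (itgt A)"
    unfolding reflexive_pair_def using a homD[OF a(3)] homD[OF a(4)] by (auto intro!: bexI[of _ "iid A"])
  then show ?thesis using R unfolding coeq_def has_reflexive_coequalisers_def by (metis someI_ex)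
qed

text \<open>The quotient maps are natural from the objects functor to \<open>Pi0 E\<close>: as
  \<open>F\<close> respects source and target, \<open>fob F\<close> followed by the quotient of
  \<open>fcod F\<close> factors through the quotient of \<open>fdom F\<close>.\<close>

lemma Pi0_naturality:
  assumes R: "has_reflexive_coequalisers E" and F: "is_ifun E F"
  shows "Far (Pi0 E) F \<in> hom E (Fob (Pi0 E) (fdom F)) (Fob (Pi0 E) (fcod F))"
    "Far (Pi0 E) F \<cdot> coeq E (isrc (fdom F)) (itgt (fdom F)) =
       coeq E (isrc (fcod F)) (itgt (fcod F)) \<cdot> fob F"
proof -
  let ?q = "\<lambda>A. coeq E (isrc A) (itgt A)"
  note f = ifunD[OF F]
  note a = icatD[OF f(1)] and b = icatD[OF f(2)]
  note qA = coeq_source_target[OF R f(1)] and qB = coeq_source_target[OF R f(2)]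
  have hB: "?q (fcod F) \<in> hom E (ob0 (fcod F)) (Cod E (?q (fcod F)))"
    "?q (fcod F) \<cdot> isrc (fcod F) = ?q (fcod F) \<cdot> itgt (fcod F)"
    using qB homD[OF b(3)] by (auto simp: is_coequaliser_def)
  have "(?q (fcod F) \<cdot> fob F) \<cdot> isrc (fdom F) = (?q (fcod F) \<cdot> fob F) \<cdot> itgt (fdom F)"
    using Comp_assoc[OF hB(1) f(3) a(3)] Comp_assoc[OF hB(1) f(3) a(4)] f(5,6)
      square_comp[OF hB(2,1) b(3) hB(1) b(4) f(4)] by simp
  then have "\<exists>!u. u \<in> hom E (Cod E (?q (fdom F))) (Cod E (?q (fcod F))) \<and> u \<cdot> ?q (fdom F) = ?q (fcod F) \<cdot> fob F"
    using qA Comp_hom[OF hB(1) f(3)] homD[OF a(3)] by (simp add: is_coequaliser_def)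
  from theI'[OF this] show
    "Far (Pi0 E) F \<in> hom E (Fob (Pi0 E) (fdom F)) (Fob (Pi0 E) (fcod F))"
    "Far (Pi0 E) F \<cdot> ?q (fdom F) = ?q (fcod F) \<cdot> fob F"
    by (simp_all add: Pi0_def Let_def)
qed

lemma nno_Pi0:
  assumes R: "has_reflexive_coequalisers E" and N: "nno (underlying (Cat E)) T N z s"
  shows "nno E (Fob (Pi0 E) T) (Fob (Pi0 E) N) (Far (Pi0 E) z) (Far (Pi0 E) s)"
proof -
  let ?q = "\<lambda>A. coeq E (isrc A) (itgt A)"
  have z: "is_ifun E z" "fdom z = T" "fcod z = N" and s: "is_ifun E s" "fdom s = N" "fcod s = N"
    using N by (simp_all add: nno_def underlying_simps Cat_simps)
  note N0 = nno_objs[OF N] and ic = ifunD(1,2)[OF z(1), unfolded z]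
  have T0: "terminal E (ob0 T)" using N0 by (simp add: nno_def)
  \<comment> \<open>For \<open>T\<close> both maps are parallel arrows into the terminal object
    \<open>ob0 T\<close>.\<close>
  have st: "isrc T = itgt T" "isrc N = itgt N"
    using terminal_unique[OF T0 icatD(2-4)[OF ic(1)]] nno_source_eq_target[OF N] by simp_all
  have iso: "\<exists>r. ?q A \<in> hom E (ob0 A) (Fob (Pi0 E) A) \<and> r \<in> hom E (Fob (Pi0 E) A) (ob0 A) \<and>
      r \<cdot> ?q A = Ident E (ob0 A) \<and> ?q A \<cdot> r = Ident E (Fob (Pi0 E) A)"
    if "is_icat E A" "isrc A = itgt A" for A
  proof -
    have q: "is_coequaliser E (isrc A) (isrc A) (?q A)"
      using coeq_source_target[OF R that(1)] that(2) by simp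
    have P: "Fob (Pi0 E) A = Cod E (?q A)" by (simp add: Pi0_def)
    have "?q A \<in> hom E (ob0 A) (Cod E (?q A))"
      using q homD[OF icatD(3)[OF that(1)]] unfolding is_coequaliser_def by simp
    then show ?thesis
      unfolding P using coequaliser_self_iso[OF q] homD[OF icatD(3)[OF that(1)]] by metis
  qed
  \<comment> \<open>The quotient maps of \<open>T\<close> and \<open>N\<close> serve as
    \<open>p\<close> and \<open>q\<close>; naturality at \<open>z\<close> and \<open>s\<close>
    supplies the compatibility with zero and successor.\<close>
  from iso[OF ic(1) st(1)] iso[OF ic(2) st(2)] show ?thesis
    using nno_transport[OF N0] Pi0_naturality[OF R z(1)] Pi0_naturality[OF R s(1)] z s by auto
qed

end

theorem theorem6p4:
  fixes E :: "('o, 'a) cat"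
  assumes "category E" and "has_finite_limits E"
  shows "(has_nno E \<longleftrightarrow> has_nno2 (Cat E)) \<and>
    (has_nno E \<longrightarrow>
       preserves_nno E (underlying (Cat E)) (disc E) \<and>
       preserves_nno (underlying (Cat E)) E objs \<and>
       (has_reflexive_coequalisers E \<longrightarrow> preserves_nno (underlying (Cat E)) E (Pi0 E)))"
proof -
  interpret finitely_complete_category E
    using assms by (simp add: finitely_complete_category_def finitely_complete_category_axioms_def)
  have "has_nno2 (Cat E)" if "has_nno E"
    using that nno2_disc unfolding has_nno_def has_nno2_def by blast
  moreover have "has_nno E" if "has_nno2 (Cat E)"
    using that nno_objs unfolding has_nno_def has_nno2_def nno2_def by blast
  \<comment> \<open>Preservation by \<open>disc E\<close> is the one-dimensional half of
    \<open>nno2_disc\<close>.\<close>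
  moreover have "preserves_nno E (underlying (Cat E)) (disc E)"
    using nno2_disc by (auto simp: preserves_nno_def nno2_def) (simp add: disc_def)
  moreover have "preserves_nno (underlying (Cat E)) E objs"
    using nno_objs by (simp add: preserves_nno_def objs_def)
  moreover have "preserves_nno (underlying (Cat E)) E (Pi0 E)" if "has_reflexive_coequalisers E"
    using nno_Pi0[OF that] by (simp add: preserves_nno_def)
  ultimately show ?thesis by blast
qed

end
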